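(* Let $\Bbbk$ be a field, $R=\Bbbk[x,y]$, and let $M=(x^{a_1}y^{b_1},\dots,x^{a_r}y^{b_r})\subseteq R$ with $a_1>a_2>\cdots>a_r\ge0$ and $0\le b_1<b_2<\cdots<b_r$, where $r>2$, or $r=2$ and $M$ is not generated by pure powers of $x$ and $y$. Let $S=R/M$. Then the total Betti numbers of the resolution of $\Bbbk$ over $S$ are given by $$\beta_i^S(\Bbbk)=\begin{cases}1&\text{if } i=0,\\ 2&\text{if } i=1,\\ \beta_{i-1}^S(\Bbbk)+(r-1)\beta_{i-2}^S(\Bbbk)&\text{if } i\ge2,\end{cases}$$ and the Poincaré–Betti series is $$P_S(z)=\frac{1+z}{1-z+(1-r)z^2}.$$
   Context: $\Bbbk$ is regarded as the $S$-module $S/(x,y)S$. The total Betti number $\beta_i^S(\Bbbk)$ is the rank of the $i$-th free module in the minimal free resolution of $\Bbbk$ over $S$ (equivalently $\dim_{\Bbbk}\operatorname{Tor}_i^S(\Bbbk,\Bbbk)$), and the Poincaré–Betti series is $P_S(z)=\sum_{i\ge0}\beta_i^S(\Bbbk)z^i$. *)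

theory Defs
  imports
    "HOL-Algebra.Algebra"
    "HOL-Algebra.Algebraic_Closure_Type"
    "HOL-Computational_Algebra.Computational_Algebra"
begin

section \<open>Modules over a commutative ring\<close>

text \<open>
  Modules are the records of \<open>HOL-Algebra.Module\<close>. These records extend ring records, so they
  also have fields \<open>mult\<close> and \<open>one\<close>, which play no role in the module structure.
\<close>

definition free_module :: "('a, 'c) ring_scheme \<Rightarrow> nat \<Rightarrow> ('a, nat \<Rightarrow> 'a) module"
  where "free_module S n =
    \<lparr>carrier = {..<n} \<rightarrow>\<^sub>E carrier S,
     monoid.mult = (\<lambda>u v. \<lambda>j\<in>{..<n}. u j \<otimes>\<^bsub>S\<^esub> v j),
     one = (\<lambda>j\<in>{..<n}. \<one>\<^bsub>S\<^esub>),
     ring.zero = (\<lambda>j\<in>{..<n}. \<zero>\<^bsub>S\<^esub>),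
     add = (\<lambda>u v. \<lambda>j\<in>{..<n}. u j \<oplus>\<^bsub>S\<^esub> v j),
     module.smult = (\<lambda>s u. \<lambda>j\<in>{..<n}. s \<otimes>\<^bsub>S\<^esub> u j)\<rparr>"

definition quotient_module :: "('a, 'c) ring_scheme \<Rightarrow> 'a set \<Rightarrow> ('a, 'a set) module"
  where "quotient_module S I =
    ring.extend (S Quot I) \<lparr>module.smult = (\<lambda>s c. (I +>\<^bsub>S\<^esub> s) \<otimes>\<^bsub>S Quot I\<^esub> c)\<rparr>"

definition module_hom ::
    "('a, 'c) ring_scheme \<Rightarrow> ('a, 'b, 'd) module_scheme \<Rightarrow> ('a, 'e, 'f) module_scheme \<Rightarrow> ('b \<Rightarrow> 'e) set"
  where "module_hom S N P =
    {f \<in> carrier N \<rightarrow> carrier P.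
       (\<forall>u\<in>carrier N. \<forall>v\<in>carrier N. f (u \<oplus>\<^bsub>N\<^esub> v) = f u \<oplus>\<^bsub>P\<^esub> f v) \<and>
       (\<forall>s\<in>carrier S. \<forall>u\<in>carrier N. f (s \<odot>\<^bsub>N\<^esub> u) = s \<odot>\<^bsub>P\<^esub> f u)}"

definition module_kernel ::
    "('a, 'b, 'd) module_scheme \<Rightarrow> ('a, 'e, 'f) module_scheme \<Rightarrow> ('b \<Rightarrow> 'e) \<Rightarrow> 'b set"
  where "module_kernel N P f = {u \<in> carrier N. f u = \<zero>\<^bsub>P\<^esub>}"

lemma free_module_is_module:
  assumes "cring S"
  shows "module S (free_module S n)"
proof -
  interpret cring S by fact
  have [simp]: "(\<lambda>j\<in>{..<n}. f j) = u \<longleftrightarrow> (\<forall>j<n. f j = u j)"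
    if "u \<in> extensional {..<n}" for f u :: "nat \<Rightarrow> 'a"
    using that by (auto simp: fun_eq_iff extensional_def)
  have [simp]: "u j \<in> carrier S" if "u \<in> {..<n} \<rightarrow>\<^sub>E carrier S" "j < n" for u j
    using that by auto
  have [simp]: "u \<in> extensional {..<n}" if "u \<in> {..<n} \<rightarrow>\<^sub>E carrier S" for u
    using that by (simp add: PiE_def)
  show ?thesis
  proof (rule moduleI)
    show "abelian_group (free_module S n)"
    proof (rule abelian_groupI)
      fix u assume u: "u \<in> carrier (free_module S n)"
      show "\<exists>v\<in>carrier (free_module S n). v \<oplus>\<^bsub>free_module S n\<^esub> u = \<zero>\<^bsub>free_module S n\<^esub>"
        using u by (intro bexI[of _ "\<lambda>j\<in>{..<n}. \<ominus>\<^bsub>S\<^esub> u j"]) (simp_all add: free_module_def l_neg)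
    qed (simp_all add: free_module_def a_ac)
  qed (use assms in \<open>simp_all add: free_module_def l_distr r_distr m_assoc\<close>)
qed

lemma quotient_module_is_module:
  assumes "cring S" "ideal I S"
  shows "module S (quotient_module S I)"
proof -
  interpret cring S by fact
  interpret I: ideal I S by fact
  interpret Q: cring "S Quot I"
    by (rule I.quotient_is_cring[OF assms(1)])
  have [simp]: "carrier (quotient_module S I) = carrier (S Quot I)"
    "add (quotient_module S I) = add (S Quot I)" "ring.zero (quotient_module S I) = ring.zero (S Quot I)"
    "module.smult (quotient_module S I) = (\<lambda>s c. (I +>\<^bsub>S\<^esub> s) \<otimes>\<^bsub>S Quot I\<^esub> c)"
    by (simp_all add: quotient_module_def ring.defs)
  note hom = I.rcos_ring_hom
  note [simp] = ring_hom_closed[OF hom] ring_hom_add[OF hom] ring_hom_mult[OF hom] ring_hom_one[OF hom]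
  show ?thesis
  proof (rule moduleI)
    show "abelian_group (quotient_module S I)"
    proof (rule abelian_groupI)
      fix c assume "c \<in> carrier (quotient_module S I)"
      then show "\<exists>c'\<in>carrier (quotient_module S I).
          c' \<oplus>\<^bsub>quotient_module S I\<^esub> c = \<zero>\<^bsub>quotient_module S I\<^esub>"
        by (intro bexI[of _ "\<ominus>\<^bsub>S Quot I\<^esub> c"]) (simp_all add: Q.l_neg)
    qed (simp_all add: Q.a_ac)
  qed (use assms in \<open>simp_all add: Q.l_distr Q.r_distr Q.m_assoc\<close>)
qed

section \<open>Minimal free resolutions and Betti numbers\<close>

text \<open>
  A resolution of \<open>N\<close> by finitely generated free modules
  \<open>\<dots> \<rightarrow> F 2 \<rightarrow> F 1 \<rightarrow> F 0 \<rightarrow> N \<rightarrow> 0\<close> with \<open>F i = free_module S (\<beta> i)\<close>, augmentation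
  \<open>\<epsilon> : F 0 \<rightarrow> N\<close>, and differentials \<open>d i : F (i + 1) \<rightarrow> F i\<close>.
\<close>

definition free_resolution ::
    "('a, 'c) ring_scheme \<Rightarrow> ('a, 'b, 'e) module_scheme \<Rightarrow>
     (nat \<Rightarrow> nat) \<Rightarrow> (nat \<Rightarrow> (nat \<Rightarrow> 'a) \<Rightarrow> (nat \<Rightarrow> 'a)) \<Rightarrow> ((nat \<Rightarrow> 'a) \<Rightarrow> 'b) \<Rightarrow> bool"
  where "free_resolution S N \<beta> d \<epsilon> \<longleftrightarrow>
    (let F = (\<lambda>i. free_module S (\<beta> i)) in
       \<epsilon> \<in> module_hom S (F 0) N \<and>
       (\<forall>i. d i \<in> module_hom S (F (Suc i)) (F i)) \<and>
       \<epsilon> ` carrier (F 0) = carrier N \<and>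
       d 0 ` carrier (F 1) = module_kernel (F 0) N \<epsilon> \<and>
       (\<forall>i. d (Suc i) ` carrier (F (Suc (Suc i))) = module_kernel (F (Suc i)) (F i) (d i)))"

text \<open>
  Minimality with respect to an ideal \<open>m\<close> means that the image of \<open>d i\<close> lies in \<open>m (F i)\<close>;
  for \<open>F i = S\<^sup>n\<close> the submodule \<open>m (F i)\<close> consists of the vectors with all entries in \<open>m\<close>.
  Below, \<open>m\<close> is the ideal generated by the variables, i.e. the homogeneous maximal ideal
  of a quotient of the polynomial ring by a monomial ideal.
\<close>

definition minimal_free_resolution ::
    "('a, 'c) ring_scheme \<Rightarrow> 'a set \<Rightarrow> ('a, 'b, 'e) module_scheme \<Rightarrow>
     (nat \<Rightarrow> nat) \<Rightarrow> (nat \<Rightarrow> (nat \<Rightarrow> 'a) \<Rightarrow> (nat \<Rightarrow> 'a)) \<Rightarrow> ((nat \<Rightarrow> 'a) \<Rightarrow> 'b) \<Rightarrow> bool"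
  where "minimal_free_resolution S m N \<beta> d \<epsilon> \<longleftrightarrow>
    free_resolution S N \<beta> d \<epsilon> \<and>
    (\<forall>i. d i ` carrier (free_module S (\<beta> (Suc i))) \<subseteq> {..<\<beta> i} \<rightarrow>\<^sub>E m)"

text \<open>
  The definite description is only meaningful if a minimal free resolution exists and its ranks
  are unique. For \<open>N = S/m\<close> with \<open>m\<close> a proper ideal, uniqueness holds because the differentials
  vanish after tensoring with \<open>S/m\<close>, so that the \<open>i\<close>-th rank is that of the free \<open>S/m\<close>-module
  \<open>Tor i (S/m, S/m)\<close>.
\<close>

definition betti_number ::
    "('a, 'c) ring_scheme \<Rightarrow> 'a set \<Rightarrow> ('a, 'b, 'e) module_scheme \<Rightarrow> nat \<Rightarrow> nat"
  where "betti_number S m N i =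
    (THE n. \<exists>\<beta> d \<epsilon>. minimal_free_resolution S m N \<beta> d \<epsilon> \<and> \<beta> i = n)"

section \<open>Quotients of the polynomial ring in two variables\<close>

text \<open>
  The ring \<open>k[x,y]\<close> is \<open>k[x][y]\<close>: the inner variable is \<open>x\<close>, the outer one is \<open>y\<close>.
\<close>

abbreviation poly_ring_xy :: "'k::field poly poly ring"
  where "poly_ring_xy \<equiv> ring_of_type_algebra"

definition var_x :: "'k::field poly poly"
  where "var_x = [:[:0, 1:]:]"

definition var_y :: "'k::field poly poly"
  where "var_y = [:0, 1:]"

definition generated_by_pure_powers :: "'k::field poly poly set \<Rightarrow> bool"
  where "generated_by_pure_powers M \<longleftrightarrow>
    (\<exists>G \<subseteq> range (\<lambda>n. var_x ^ n) \<union> range (\<lambda>n. var_y ^ n). M = Idl\<^bsub>poly_ring_xy\<^esub> G)"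

definition ideal_xy :: "'k::field poly poly set \<Rightarrow> 'k poly poly set set"
  where "ideal_xy M =
    Idl\<^bsub>poly_ring_xy Quot M\<^esub> {M +>\<^bsub>poly_ring_xy\<^esub> var_x, M +>\<^bsub>poly_ring_xy\<^esub> var_y}"

text \<open>
  In the following two definitions \<open>S = k[x,y]/M\<close>, and the residue field \<open>k\<close> is the \<open>S\<close>-module
  \<open>S/(x,y)S\<close>.
\<close>

definition residue_betti :: "'k::field poly poly set \<Rightarrow> nat \<Rightarrow> nat"
  where "residue_betti M =
    (let S = poly_ring_xy Quot M
     in betti_number S (ideal_xy M) (quotient_module S (ideal_xy M)))"

definition poincare_betti_series :: "'k::field poly poly set \<Rightarrow> rat fps"
  where "poincare_betti_series M = Abs_fps (\<lambda>i. of_nat (residue_betti M i))"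

end

theory Submission
  imports Defs "HOL-Library.Extended_Nat"
begin

text \<open>
  Let \<open>R = k[x,y]\<close>, \<open>S = R/M\<close> and \<open>m = (x,y)S\<close>. The proof writes down one minimal free resolution
  of \<open>k = S/m\<close> whose bases are sets of words, counts these words, and separately shows that the ranks
  in a minimal free resolution are unique.

  The resolution comes from a family of modules that is closed under syzygies. For a height \<open>c\<close>, put
  \<open>C c = S/(x, y^c)\<close>, where \<open>y^\<infinity> = 0\<close>; thus \<open>k = C 1\<close>. Two facts about the staircase of \<open>M\<close>
  are used.

  \<^item> The annihilator of \<open>x\<close> in \<open>S\<close> is spanned by the monomials on the right-hand boundary of the
    staircase. These form columns, so the annihilator is the direct sum of the cyclic modules generated
    by the monomials \<open>x^(a l - 1) y^(b l)\<close> with \<open>a l > 0\<close>, and the \<open>l\<close>-th summand is \<open>C h\<close>, where \<open>h\<close> is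
    \<open>b (l + 1) - b l\<close>, or \<open>\<infinity>\<close> if \<open>l = r\<close>.
    As \<open>xS = S/(0 : x)\<close>, a resolution of \<open>S/xS\<close> starts with \<open>S \<leftarrow> S\<close>, multiplication by \<open>x\<close>, and goes
    on with the direct sum of the resolutions of these \<open>C h\<close>.

  \<^item> Let \<open>B\<close> be \<open>b r\<close> if \<open>a r = 0\<close>, and \<open>\<infinity>\<close> otherwise, so that \<open>S/xS = k[y]/(y^B)\<close>. The kernel of
    \<open>S/xS \<rightarrow> C c\<close> is generated by \<open>y^c\<close> and isomorphic to \<open>C (B - c)\<close>. Multiplication by \<open>y^c\<close> on the
    common part, extended by \<open>0\<close>, is a chain map from the resolution of \<open>C (B - c)\<close> to that
    of \<open>S/xS\<close>, because \<open>y^c y^(B - c) = 0\<close> in \<open>S\<close>; its mapping cone resolves \<open>C c\<close>.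

  Unrolling both steps gives a basis of words. A letter for a column costs two homological degrees, a
  passage from \<open>c\<close> to \<open>B - c\<close> costs one, and every word ends in degree \<open>0\<close> or \<open>1\<close>. If \<open>B\<close> is finite, there
  are \<open>r - 1\<close> columns, and counting words by their first letter gives the recursion
  \<open>\<beta> i = \<beta> (i - 1) + (r - 1) \<beta> (i - 2)\<close> at once; if \<open>B = \<infinity>\<close>, there is one more column, of infinite
  height, and no passage from \<open>\<infinity>\<close>, and the two effects cancel (lemma \<open>card_words\<close>).

  All coefficients of the differential are \<open>x\<close>, column generators, or powers \<open>y^c\<close>. They lie in \<open>m\<close>
  because every height that occurs is positive and, if finite, less than \<open>B\<close>. This is the point where
  complete intersections must be excluded: for \<open>M = (x^a, y^b)\<close> the only column has height
  \<open>B\<close>, and the passage to \<open>B - B = 0\<close> would bring in the unit \<open>y^0\<close>.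

  Exactness is shown in \<open>R\<close> modulo \<open>M\<close> (lemma \<open>exact\<close>) and carried over to \<open>S\<close> by lemma
  \<open>minimal_free_resolution_quotient\<close>. Uniqueness of the ranks is \<open>betti_number_eq\<close>: the comparison maps
  between two minimal resolutions of the same module are inverse to each other modulo \<open>m\<close>, since
  homotopies composed with minimal differentials vanish there.
\<close>

section \<open>Uniqueness of the ranks of minimal free resolutions\<close>

lemma free_module_simps [simp]:
  "carrier (free_module S n) = {..<n} \<rightarrow>\<^sub>E carrier S"
  "\<zero>\<^bsub>free_module S n\<^esub> = (\<lambda>j\<in>{..<n}. \<zero>\<^bsub>S\<^esub>)"
  "u \<oplus>\<^bsub>free_module S n\<^esub> v = (\<lambda>j\<in>{..<n}. u j \<oplus>\<^bsub>S\<^esub> v j)"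
  "s \<odot>\<^bsub>free_module S n\<^esub> u = (\<lambda>j\<in>{..<n}. s \<otimes>\<^bsub>S\<^esub> u j)"
  by (simp_all add: free_module_def)

lemma module_hom_closed: "f \<in> module_hom S N P \<Longrightarrow> u \<in> carrier N \<Longrightarrow> f u \<in> carrier P"
  and module_hom_add: "f \<in> module_hom S N P \<Longrightarrow> u \<in> carrier N \<Longrightarrow> v \<in> carrier N \<Longrightarrow> f (u \<oplus>\<^bsub>N\<^esub> v) = f u \<oplus>\<^bsub>P\<^esub> f v"
  and module_hom_smult: "f \<in> module_hom S N P \<Longrightarrow> s \<in> carrier S \<Longrightarrow> u \<in> carrier N \<Longrightarrow> f (s \<odot>\<^bsub>N\<^esub> u) = s \<odot>\<^bsub>P\<^esub> f u"
  by (auto simp: module_hom_def)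

lemma module_hom_zero:
  assumes "module S N" "module S P" "f \<in> module_hom S N P"
  shows "f \<zero>\<^bsub>N\<^esub> = \<zero>\<^bsub>P\<^esub>"
proof -
  interpret N: module S N by fact
  interpret P: module S P by fact
  have "f (\<zero>\<^bsub>S\<^esub> \<odot>\<^bsub>N\<^esub> \<zero>\<^bsub>N\<^esub>) = \<zero>\<^bsub>S\<^esub> \<odot>\<^bsub>P\<^esub> f \<zero>\<^bsub>N\<^esub>"
    using assms(3) by (intro module_hom_smult) auto
  then show ?thesis
    using module_hom_closed[OF assms(3) N.zero_closed] by simp
qed

lemma module_hom_comp:
  assumes "f \<in> module_hom S N P" "g \<in> module_hom S P Q"
  shows "(\<lambda>u. g (f u)) \<in> module_hom S N Q"
  using assms unfolding module_hom_def by (auto simp: Pi_iff)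

lemma module_hom_diff:
  assumes "module S N" "module S P" "f \<in> module_hom S N P" "g \<in> module_hom S N P"
  shows "(\<lambda>u. f u \<ominus>\<^bsub>P\<^esub> g u) \<in> module_hom S N P"
proof -
  interpret N: module S N by fact
  interpret P: module S P by fact
  note [simp] = assms(3,4)[THEN module_hom_closed] assms(3,4)[THEN module_hom_add] assms(3,4)[THEN module_hom_smult]
  show ?thesis
    unfolding module_hom_def
    by (auto simp: P.minus_eq P.minus_add P.a_ac P.smult_r_distr P.smult_r_minus)
qed

lemma module_hom_id: "module S N \<Longrightarrow> (\<lambda>u. u) \<in> module_hom S N N"
  by (auto simp: module_hom_def)

lemma module_hom_finsum:
  assumes "module S N" "module S P" "f \<in> module_hom S N P" "finite A" "g \<in> A \<rightarrow> carrier N"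
  shows "f (finsum N g A) = finsum P (\<lambda>a. f (g a)) A"
proof -
  interpret N: module S N by fact
  interpret P: module S P by fact
  show ?thesis using assms(4,5)
  proof (induction A rule: finite_induct)
    case empty
    then show ?case using module_hom_zero[OF assms(1-3)] by simp
  next
    case (insert a A)
    then have "g a \<in> carrier N" "g \<in> A \<rightarrow> carrier N" by auto
    moreover have "f (g a) \<in> carrier P" "(\<lambda>a. f (g a)) \<in> A \<rightarrow> carrier P"
      using calculation module_hom_closed[OF assms(3)] by auto
    ultimately show ?case
      using insert by (simp add: module_hom_add[OF assms(3)])
  qed
qed

definition unit_vector :: "('a, 'c) ring_scheme \<Rightarrow> nat \<Rightarrow> nat \<Rightarrow> nat \<Rightarrow> 'a" where
  "unit_vector S n j = (\<lambda>k\<in>{..<n}. if k = j then \<one>\<^bsub>S\<^esub> else \<zero>\<^bsub>S\<^esub>)"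

lemma unit_vector_closed: "cring S \<Longrightarrow> unit_vector S n j \<in> {..<n} \<rightarrow>\<^sub>E carrier S"
proof -
  assume "cring S"
  then interpret cring S .
  show ?thesis by (auto simp: unit_vector_def)
qed

lemma unit_vector_nth: "k < n \<Longrightarrow> unit_vector S n j k = (if k = j then \<one>\<^bsub>S\<^esub> else \<zero>\<^bsub>S\<^esub>)"
  by (simp add: unit_vector_def)

lemma finsum_free_module_nth:
  assumes "cring S" "finite A" "g \<in> A \<rightarrow> ({..<n} \<rightarrow>\<^sub>E carrier S)" "k < n"
  shows "finsum (free_module S n) g A k = finsum S (\<lambda>a. g a k) A"
proof -
  interpret cring S by fact
  interpret F: module S "free_module S n" by (rule free_module_is_module) fact
  show ?thesis using assms(2,3)
  proof (induction A rule: finite_induct)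
    case (insert a A)
    then have g: "g a \<in> {..<n} \<rightarrow>\<^sub>E carrier S" "g \<in> A \<rightarrow> ({..<n} \<rightarrow>\<^sub>E carrier S)" by auto
    then have "g a k \<in> carrier S" "(\<lambda>a. g a k) \<in> A \<rightarrow> carrier S" using assms(4) by (auto simp: PiE_def Pi_iff)
    then show ?case using insert g assms(4) by simp
  qed (use assms in simp)
qed

lemma free_module_expansion:
  assumes "cring S" "u \<in> {..<n} \<rightarrow>\<^sub>E carrier S"
  shows "u = finsum (free_module S n) (\<lambda>j. u j \<odot>\<^bsub>free_module S n\<^esub> unit_vector S n j) {..<n}"
    (is "u = ?v")
proof (rule PiE_ext[OF assms(2)])
  interpret cring S by fact
  interpret F: module S "free_module S n" by (rule free_module_is_module) fact
  have c: "(\<lambda>j. u j \<odot>\<^bsub>free_module S n\<^esub> unit_vector S n j) \<in> {..<n} \<rightarrow> ({..<n} \<rightarrow>\<^sub>E carrier S)"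
    using assms by (fastforce simp: unit_vector_def PiE_def Pi_iff)
  then show "?v \<in> {..<n} \<rightarrow>\<^sub>E carrier S"
    using F.finsum_closed[of "\<lambda>j. u j \<odot>\<^bsub>free_module S n\<^esub> unit_vector S n j" "{..<n}"] by simp
  fix k assume k: "k \<in> {..<n}"
  have uc: "\<And>j. j < n \<Longrightarrow> u j \<in> carrier S" using assms by auto
  have "?v k = finsum S (\<lambda>j. if k = j then u j else \<zero>\<^bsub>S\<^esub>) {..<n}"
    using k uc by (subst finsum_free_module_nth[OF assms(1) _ c]) (auto simp: unit_vector_def intro!: add.finprod_cong')
  also have "\<dots> = u k"
    using k uc by (subst add.finprod_singleton) auto
  finally show "u k = ?v k" by simp
qed

text \<open>
  Projectivity of free modules: choose preimages under \<open>d\<close> of the images of the unit vectors and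
  extend linearly.
\<close>

lemma free_module_lift:
  assumes "cring S" "module S P" "module S Q"
    and f: "f \<in> module_hom S (free_module S n) P" and d: "d \<in> module_hom S Q P"
    and sub: "f ` carrier (free_module S n) \<subseteq> d ` carrier Q"
  obtains h where "h \<in> module_hom S (free_module S n) Q"
    "\<And>u. u \<in> carrier (free_module S n) \<Longrightarrow> d (h u) = f u"
proof -
  interpret cring S by fact
  interpret F: module S "free_module S n" by (rule free_module_is_module) fact
  interpret Q: module S Q by fact
  interpret P: module S P by fact
  have "f (unit_vector S n j) \<in> d ` carrier Q" for j
    using unit_vector_closed[OF assms(1), of n j] by (intro subsetD[OF sub] imageI) simp
  then have "\<exists>v. v \<in> carrier Q \<and> d v = f (unit_vector S n j)" for j
    by (metis imageE)
  then obtain v where v: "\<And>j. v j \<in> carrier Q" "\<And>j. d (v j) = f (unit_vector S n j)" by metis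
  define h where "h = (\<lambda>u. finsum Q (\<lambda>j. u j \<odot>\<^bsub>Q\<^esub> v j) {..<n})"
  have uc [simp]: "u j \<in> carrier S" if "u \<in> {..<n} \<rightarrow>\<^sub>E carrier S" "j < n" for u j
    using that by auto
  have "h \<in> module_hom S (free_module S n) Q"
    unfolding module_hom_def
  proof (intro CollectI conjI ballI)
    show "h \<in> carrier (free_module S n) \<rightarrow> carrier Q"
      by (auto simp: h_def v intro!: Q.finsum_closed)
  next
    fix u w assume *: "u \<in> carrier (free_module S n)" "w \<in> carrier (free_module S n)"
    then have "h (u \<oplus>\<^bsub>free_module S n\<^esub> w) = finsum Q (\<lambda>j. (u j \<odot>\<^bsub>Q\<^esub> v j) \<oplus>\<^bsub>Q\<^esub> (w j \<odot>\<^bsub>Q\<^esub> v j)) {..<n}"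
      unfolding h_def by (intro Q.add.finprod_cong') (auto simp: v Q.smult_l_distr)
    also have "\<dots> = h u \<oplus>\<^bsub>Q\<^esub> h w"
      unfolding h_def using * by (intro Q.finsum_addf) (auto simp: v)
    finally show "h (u \<oplus>\<^bsub>free_module S n\<^esub> w) = h u \<oplus>\<^bsub>Q\<^esub> h w" .
  next
    fix s u assume *: "s \<in> carrier S" "u \<in> carrier (free_module S n)"
    then have "h (s \<odot>\<^bsub>free_module S n\<^esub> u) = finsum Q (\<lambda>j. s \<odot>\<^bsub>Q\<^esub> (u j \<odot>\<^bsub>Q\<^esub> v j)) {..<n}"
      unfolding h_def by (intro Q.add.finprod_cong') (auto simp: v Q.smult_assoc1)
    also have "\<dots> = s \<odot>\<^bsub>Q\<^esub> h u"
      unfolding h_def using * by (intro Q.finsum_smult_ldistr[symmetric]) (auto simp: v)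
    finally show "h (s \<odot>\<^bsub>free_module S n\<^esub> u) = s \<odot>\<^bsub>Q\<^esub> h u" .
  qed
  moreover have "d (h u) = f u" if "u \<in> carrier (free_module S n)" for u
  proof -
    have u: "u \<in> {..<n} \<rightarrow>\<^sub>E carrier S" using that by simp
    have "f u = f (finsum (free_module S n) (\<lambda>j. u j \<odot>\<^bsub>free_module S n\<^esub> unit_vector S n j) {..<n})"
      using free_module_expansion[OF assms(1) u] by simp
    also have "\<dots> = finsum P (\<lambda>j. f (u j \<odot>\<^bsub>free_module S n\<^esub> unit_vector S n j)) {..<n}"
      using u unit_vector_closed[OF assms(1), of n]
      by (intro module_hom_finsum[OF F.module_axioms P.module_axioms f] Pi_I F.smult_closed) auto
    also have "\<dots> = finsum P (\<lambda>j. u j \<odot>\<^bsub>P\<^esub> d (v j)) {..<n}"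
      using u unit_vector_closed[OF assms(1), of n] module_hom_closed[OF d] v(1)
      by (intro P.add.finprod_cong' refl)
        (simp_all del: free_module_simps(4) add: v(2)[symmetric] module_hom_smult[OF f] v(1) Pi_iff)
    also have "\<dots> = d (h u)"
      unfolding h_def using u v(1)
      by (subst module_hom_finsum[OF Q.module_axioms P.module_axioms d])
        (auto intro!: P.add.finprod_cong' simp: module_hom_smult[OF d] module_hom_closed[OF d])
    finally show ?thesis by simp
  qed
  ultimately show thesis using that by blast
qed

text \<open>
  A linear map is given by a matrix, so it maps vectors with entries in \<open>m\<close> to such vectors. This lets
  homs be reduced modulo \<open>m\<close> without forming the quotient modules.
\<close>

lemma module_hom_ideal_vectors:
  assumes "cring S" "ideal m S" and h: "h \<in> module_hom S (free_module S n) (free_module S l)"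
    and u: "u \<in> {..<n} \<rightarrow>\<^sub>E m"
  shows "h u \<in> {..<l} \<rightarrow>\<^sub>E m"
proof -
  interpret cring S by fact
  interpret m: ideal m S by fact
  interpret F: module S "free_module S n" by (rule free_module_is_module) fact
  interpret G: module S "free_module S l" by (rule free_module_is_module) fact
  have uS: "u \<in> {..<n} \<rightarrow>\<^sub>E carrier S" using u m.Icarr by (auto simp: PiE_def Pi_iff)
  have hu: "h v \<in> {..<l} \<rightarrow>\<^sub>E carrier S" if "v \<in> {..<n} \<rightarrow>\<^sub>E carrier S" for v
    using module_hom_closed[OF h, of v] that by simp
  have he: "h (unit_vector S n j) \<in> {..<l} \<rightarrow>\<^sub>E carrier S" for j
    using hu[OF unit_vector_closed[OF assms(1)]] .
  have hs: "(\<lambda>j. h (u j \<odot>\<^bsub>free_module S n\<^esub> unit_vector S n j)) \<in> {..<n} \<rightarrow> ({..<l} \<rightarrow>\<^sub>E carrier S)"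
  proof (intro Pi_I hu)
    fix j assume "j \<in> {..<n}"
    then have "u j \<in> carrier S" using uS by auto
    then show "u j \<odot>\<^bsub>free_module S n\<^esub> unit_vector S n j \<in> {..<n} \<rightarrow>\<^sub>E carrier S"
      using F.smult_closed[of "u j" "unit_vector S n j"] unit_vector_closed[OF assms(1)]
      unfolding free_module_simps(1) by blast
  qed
  have "h u k \<in> m" if "k < l" for k
  proof -
    have "h u = h (finsum (free_module S n) (\<lambda>j. u j \<odot>\<^bsub>free_module S n\<^esub> unit_vector S n j) {..<n})"
      using free_module_expansion[OF assms(1) uS] by simp
    also have "\<dots> = finsum (free_module S l) (\<lambda>j. h (u j \<odot>\<^bsub>free_module S n\<^esub> unit_vector S n j)) {..<n}"
      using uS unit_vector_closed[OF assms(1), of n]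
      by (intro module_hom_finsum[OF F.module_axioms G.module_axioms h] Pi_I F.smult_closed) auto
    finally have "h u k = finsum S (\<lambda>j. h (u j \<odot>\<^bsub>free_module S n\<^esub> unit_vector S n j) k) {..<n}"
      using finsum_free_module_nth[OF assms(1) finite_lessThan hs that] by simp
    also have "\<dots> \<in> m"
    proof -
      have "finsum S f A \<in> m" if "finite A" "f \<in> A \<rightarrow> m" for f and A :: "nat set"
        using that
      proof (induction A rule: finite_induct)
        case (insert a A)
        then have "f \<in> A \<rightarrow> carrier S" "f a \<in> carrier S" using m.Icarr by (auto simp: Pi_iff)
        then show ?case using insert by (auto intro: m.a_closed)
      qed auto
      moreover have "h (u j \<odot>\<^bsub>free_module S n\<^esub> unit_vector S n j) k \<in> m" if j: "j < n" for j
      proof -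
        have uj: "u j \<in> m" "u j \<in> carrier S" using u uS j by auto
        have "h (u j \<odot>\<^bsub>free_module S n\<^esub> unit_vector S n j) k = u j \<otimes>\<^bsub>S\<^esub> h (unit_vector S n j) k"
          using \<open>k < l\<close> uj unit_vector_closed[OF assms(1), of n j]
          by (subst module_hom_smult[OF h]) auto
        moreover have "h (unit_vector S n j) k \<in> carrier S" using he[of j] \<open>k < l\<close> by auto
        ultimately show ?thesis using uj m.I_r_closed by simp
      qed
      ultimately show ?thesis by simp
    qed
    finally show ?thesis .
  qed
  then show ?thesis using hu[OF uS] by (auto simp: PiE_def Pi_iff)
qed

lemma maximalideal_inverse:
  assumes "cring S" "maximalideal m S" "c \<in> carrier S" "c \<notin> m"
  obtains t where "t \<in> carrier S" "\<one>\<^bsub>S\<^esub> \<ominus>\<^bsub>S\<^esub> t \<otimes>\<^bsub>S\<^esub> c \<in> m"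
proof -
  interpret cring S by fact
  interpret m: maximalideal m S by fact
  interpret Q: field "S Quot m" by (rule m.quotient_is_field) fact
  note hom = m.rcos_ring_hom
  have "m +>\<^bsub>S\<^esub> c \<in> carrier (S Quot m)" using hom assms(3) by (rule ring_hom_closed)
  moreover have "m +>\<^bsub>S\<^esub> c \<noteq> \<zero>\<^bsub>S Quot m\<^esub>"
    using assms m.rcos_const_imp_mem by (auto simp: FactRing_def)
  ultimately obtain T where T: "T \<in> carrier (S Quot m)" "T \<otimes>\<^bsub>S Quot m\<^esub> (m +>\<^bsub>S\<^esub> c) = \<one>\<^bsub>S Quot m\<^esub>"
    using Q.field_Units Q.Units_l_inv_ex[of "m +>\<^bsub>S\<^esub> c"] by force
  have "T \<in> (\<Union>a\<in>carrier S. {m +>\<^bsub>S\<^esub> a})"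
    using T(1) by (simp add: FactRing_def A_RCOSETS_def')
  then obtain t where t: "t \<in> carrier S" "T = m +>\<^bsub>S\<^esub> t"
    by (elim UN_E singletonE)
  have "m +>\<^bsub>S\<^esub> (t \<otimes>\<^bsub>S\<^esub> c) = m +>\<^bsub>S\<^esub> \<one>\<^bsub>S\<^esub>"
    using T(2) t assms(3) by (simp add: ring_hom_mult[OF hom] ring_hom_one[OF hom])
  then have "\<one>\<^bsub>S\<^esub> \<ominus>\<^bsub>S\<^esub> t \<otimes>\<^bsub>S\<^esub> c \<in> m"
    using quotient_eq_iff_same_a_r_cos[OF m.is_ideal one_closed, of "t \<otimes>\<^bsub>S\<^esub> c"] t assms(3) by simp
  then show thesis using that t(1) by blast
qed

text \<open>
  Over the field \<open>S/m\<close> this says that a linear map into a space of smaller dimension has a nonzero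
  kernel. The proof is Gaussian elimination one target coordinate at a time: it keeps a family of
  vectors \<open>b j\<close>, \<open>j \<in> J\<close>, that is triangular modulo \<open>m\<close> on the coordinates in \<open>J\<close>, and each target
  coordinate that is cleared removes one index from \<open>J\<close>.
\<close>

lemma exists_vector_mapped_into_maximalideal:
  assumes "cring S" "maximalideal m S"
    and f: "f \<in> module_hom S (free_module S n) (free_module S l)" and "l < n"
  obtains u where "u \<in> {..<n} \<rightarrow>\<^sub>E carrier S" "u \<notin> {..<n} \<rightarrow>\<^sub>E m" "f u \<in> {..<l} \<rightarrow>\<^sub>E m"
proof -
  interpret cring S by fact
  interpret m: maximalideal m S by fact
  have one: "\<one>\<^bsub>S\<^esub> \<notin> m" using m.I_notcarr m.one_imp_carrier by blast
  have fc: "f u k \<in> carrier S" if "u \<in> {..<n} \<rightarrow>\<^sub>E carrier S" "k < l" for u k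
    using module_hom_closed[OF f, of u] that by auto
  let ?b = "\<lambda>k J b. \<forall>j\<in>J. b j \<in> {..<n} \<rightarrow>\<^sub>E carrier S \<and> b j j \<notin> m \<and>
    (\<forall>i\<in>J. i \<noteq> j \<longrightarrow> b j i \<in> m) \<and> (\<forall>k'<k. f (b j) k' \<in> m)"
  have "\<exists>J b. J \<subseteq> {..<n} \<and> card J = n - k \<and> ?b k J b" if "k \<le> l" for k
    using that
  proof (induction k)
    case 0
    show ?case
      using unit_vector_closed[OF assms(1), of n] one
      by (intro exI[of _ "{..<n}"] exI[of _ "unit_vector S n"]) (simp add: unit_vector_nth)
  next
    case (Suc k)
    then obtain J b where J: "J \<subseteq> {..<n}" "card J = n - k" and b: "?b k J b" by auto
    have k: "k < l" "k < n" using Suc.prems \<open>l < n\<close> by auto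
    have bc: "b j i \<in> carrier S" if "j \<in> J" "i < n" for i j using b that by auto
    show ?case
    proof (cases "\<forall>j\<in>J. f (b j) k \<in> m")
      case True
      have "J \<noteq> {}" using J k by auto
      then obtain j where j: "j \<in> J" by blast
      have "card (J - {j}) = n - Suc k"
        using J j finite_subset[OF J(1)] by (simp add: card_Diff_singleton)
      then show ?thesis
        using J b True by (intro exI[of _ "J - {j}"] exI[of _ b]) (auto simp: less_Suc_eq)
    next
      case False
      then obtain j0 where j0: "j0 \<in> J" "f (b j0) k \<notin> m" by blast
      obtain t where t: "t \<in> carrier S" "\<one>\<^bsub>S\<^esub> \<ominus>\<^bsub>S\<^esub> t \<otimes>\<^bsub>S\<^esub> f (b j0) k \<in> m"
        using maximalideal_inverse[OF assms(1,2) _ j0(2)] fc[of "b j0" k] b j0 k by blast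
      define c where "c = (\<lambda>j. \<ominus>\<^bsub>S\<^esub> (f (b j) k \<otimes>\<^bsub>S\<^esub> t))"
      \<comment> \<open>Subtract the multiple of the pivot vector \<open>b j0\<close> that clears the target coordinate \<open>k\<close> modulo \<open>m\<close>.\<close>
      define b' where "b' = (\<lambda>j. b j \<oplus>\<^bsub>free_module S n\<^esub> c j \<odot>\<^bsub>free_module S n\<^esub> b j0)"
      have fbc: "f (b j) i \<in> carrier S" if "j \<in> J" "i < l" for j i
        using fc b that by blast
      have cc: "c j \<in> carrier S" if "j \<in> J" for j using fbc[OF that] k t by (simp add: c_def)
      have bj: "b j \<in> {..<n} \<rightarrow>\<^sub>E carrier S" if "j \<in> J" for j using b that by blast
      have b'_nth: "b' j i = b j i \<oplus>\<^bsub>S\<^esub> c j \<otimes>\<^bsub>S\<^esub> b j0 i" if "i < n" for i j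
        using that by (simp add: b'_def)
      have fb': "f (b' j) i = f (b j) i \<oplus>\<^bsub>S\<^esub> c j \<otimes>\<^bsub>S\<^esub> f (b j0) i" if j: "j \<in> J" and "i < l" for i j
      proof -
        have "c j \<odot>\<^bsub>free_module S n\<^esub> b j0 \<in> carrier (free_module S n)"
          using cc[OF j] bc[OF j0(1)] by auto
        then have "f (b' j) = f (b j) \<oplus>\<^bsub>free_module S l\<^esub> c j \<odot>\<^bsub>free_module S l\<^esub> f (b j0)"
          unfolding b'_def using module_hom_smult[OF f cc[OF j], of "b j0"] bj[OF j] bj[OF j0(1)]
          by (subst module_hom_add[OF f]) simp_all
        then show ?thesis using \<open>i < l\<close> by simp
      qed
      have "b' j \<in> {..<n} \<rightarrow>\<^sub>E carrier S" if "j \<in> J" for j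
        using bc[OF that] cc[OF that] bc[OF j0(1)] by (auto simp: b'_def)
      moreover have "b' j i \<in> m" if "j \<in> J - {j0}" "i \<in> J - {j0}" "i \<noteq> j" for i j
      proof -
        have "b j i \<in> m" "b j0 i \<in> m" "i < n" using b that j0 J by auto
        then show ?thesis using cc[of j] that by (simp add: b'_nth m.I_l_closed m.a_closed)
      qed
      moreover have "b' j j \<notin> m" if j: "j \<in> J - {j0}" for j
      proof
        assume a: "b' j j \<in> m"
        have 1: "b j0 j \<in> m" "j < n" "b j j \<notin> m" using b j j0 J by auto
        have 2: "c j \<otimes>\<^bsub>S\<^esub> b j0 j \<in> m" using 1 cc[of j] j by (simp add: m.I_l_closed)
        have "b' j j \<ominus>\<^bsub>S\<^esub> c j \<otimes>\<^bsub>S\<^esub> b j0 j \<in> m"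
          using a 2 by (simp add: minus_eq m.a_closed)
        moreover have "b' j j \<ominus>\<^bsub>S\<^esub> c j \<otimes>\<^bsub>S\<^esub> b j0 j = b j j"
          using bc[of j j] cc[of j] bc[of j0 j] j j0 1 by (simp add: b'_nth minus_eq a_assoc r_neg)
        ultimately show False using 1 by simp
      qed
      moreover have "f (b' j) k' \<in> m" if j: "j \<in> J" and k': "k' < Suc k" for j k'
      proof (cases "k' = k")
        case True
        have "f (b' j) k = f (b j) k \<otimes>\<^bsub>S\<^esub> (\<one>\<^bsub>S\<^esub> \<ominus>\<^bsub>S\<^esub> t \<otimes>\<^bsub>S\<^esub> f (b j0) k)"
          using fbc[OF j k(1)] fbc[OF j0(1) k(1)] t(1) j
          by (simp add: fb' k c_def minus_eq r_distr r_minus l_minus m_assoc)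
        then show ?thesis using t(2) fbc[OF j k(1)] True by (simp add: m.I_l_closed)
      next
        case False
        then have "k' < k" using k' by simp
        then have "f (b j) k' \<in> m" "f (b j0) k' \<in> m" using b j j0 by auto
        then show ?thesis using cc[OF j] k j \<open>k' < k\<close> by (simp add: fb' m.I_l_closed m.a_closed)
      qed
      moreover have "card (J - {j0}) = n - Suc k"
        using J j0 finite_subset[OF J(1)] by (simp add: card_Diff_singleton)
      ultimately show ?thesis
        using J by (intro exI[of _ "J - {j0}"] exI[of _ b']) auto
    qed
  qed
  from this[of l] obtain J b where J: "J \<subseteq> {..<n}" "card J = n - l" and b: "?b l J b" by auto
  have "J \<noteq> {}" using J \<open>l < n\<close> by auto
  then obtain j where j: "j \<in> J" by blast
  have "f (b j) \<in> {..<l} \<rightarrow>\<^sub>E carrier S" using module_hom_closed[OF f, of "b j"] b j by auto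
  then have "f (b j) \<in> {..<l} \<rightarrow>\<^sub>E m" using b j by (auto simp: PiE_def Pi_iff)
  moreover have "b j \<notin> {..<n} \<rightarrow>\<^sub>E m"
  proof
    assume "b j \<in> {..<n} \<rightarrow>\<^sub>E m"
    then have "b j j \<in> m" using j J by auto
    then show False using b j by blast
  qed
  ultimately show thesis using that[of "b j"] b j by blast
qed

lemma rank_le_if_left_inverse_mod_maximalideal:
  assumes "cring S" "maximalideal m S"
    and f: "f \<in> module_hom S (free_module S n) (free_module S l)"
    and g: "g \<in> module_hom S (free_module S l) (free_module S n)"
    and gf: "\<And>u. u \<in> {..<n} \<rightarrow>\<^sub>E carrier S \<Longrightarrow> g (f u) \<ominus>\<^bsub>free_module S n\<^esub> u \<in> {..<n} \<rightarrow>\<^sub>E m"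
  shows "n \<le> l"
proof (rule ccontr)
  assume "\<not> n \<le> l"
  interpret cring S by fact
  interpret m: maximalideal m S by fact
  interpret F: module S "free_module S n" by (rule free_module_is_module) fact
  obtain u where u: "u \<in> {..<n} \<rightarrow>\<^sub>E carrier S" "u \<notin> {..<n} \<rightarrow>\<^sub>E m" and fu: "f u \<in> {..<l} \<rightarrow>\<^sub>E m"
    using exists_vector_mapped_into_maximalideal[OF assms(1,2) f] \<open>\<not> n \<le> l\<close> not_le by metis
  let ?w = "g (f u)"
  have w: "?w \<in> {..<n} \<rightarrow>\<^sub>E m" by (rule module_hom_ideal_vectors[OF assms(1) m.is_ideal g fu])
  then have wS: "?w \<in> {..<n} \<rightarrow>\<^sub>E carrier S" using m.Icarr by (auto simp: PiE_def Pi_iff)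
  have d: "?w \<ominus>\<^bsub>free_module S n\<^esub> u \<in> {..<n} \<rightarrow>\<^sub>E m" by (rule gf[OF u(1)])
  then have dS: "?w \<ominus>\<^bsub>free_module S n\<^esub> u \<in> {..<n} \<rightarrow>\<^sub>E carrier S" using m.Icarr by (auto simp: PiE_def Pi_iff)
  have "(?w \<ominus>\<^bsub>free_module S n\<^esub> u) \<oplus>\<^bsub>free_module S n\<^esub> u = ?w"
    using F.a_assoc[of ?w "\<ominus>\<^bsub>free_module S n\<^esub> u" u] F.l_neg[of u] F.r_zero[of ?w] F.a_inv_closed[of u] wS u
    by (simp add: F.minus_eq del: free_module_simps(2,3))
  then have eq: "(?w \<ominus>\<^bsub>free_module S n\<^esub> u) i \<oplus>\<^bsub>S\<^esub> u i = ?w i" if "i < n" for i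
    using that by (simp add: fun_eq_iff) metis
  have "u i \<in> m" if i: "i < n" for i
  proof -
    let ?d = "(?w \<ominus>\<^bsub>free_module S n\<^esub> u) i"
    have c: "?d \<in> m" "?w i \<in> m" "u i \<in> carrier S" "?d \<in> carrier S" using d w u dS i by auto
    have "u i = \<ominus>\<^bsub>S\<^esub> ?d \<oplus>\<^bsub>S\<^esub> ?w i" using eq[OF i] c r_neg1 by metis
    then show ?thesis using c by (simp add: m.a_closed)
  qed
  then show False using u by (auto simp: PiE_def Pi_iff)
qed

text \<open>
  Exactness with the kernels written out, the form in which liftings use it.
\<close>

lemma resolution_exactness:
  assumes "free_resolution S N \<beta> d \<epsilon>"
  shows "\<epsilon> \<in> module_hom S (free_module S (\<beta> 0)) N"
    and "d i \<in> module_hom S (free_module S (\<beta> (Suc i))) (free_module S (\<beta> i))"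
    and "\<epsilon> ` carrier (free_module S (\<beta> 0)) = carrier N"
    and "d 0 ` carrier (free_module S (\<beta> 1)) = {u \<in> carrier (free_module S (\<beta> 0)). \<epsilon> u = \<zero>\<^bsub>N\<^esub>}"
    and "d (Suc i) ` carrier (free_module S (\<beta> (Suc (Suc i)))) =
      {u \<in> carrier (free_module S (\<beta> (Suc i))). d i u = \<zero>\<^bsub>free_module S (\<beta> i)\<^esub>}"
  using assms unfolding free_resolution_def Let_def module_kernel_def by auto

text \<open>
  The comparison theorem. The choice in degree \<open>i + 1\<close> needs only that the map in degree \<open>i\<close>
  preserves boundaries; this invariant has the same form in degree \<open>0\<close>, where the
  boundaries are the kernel of the augmentation.
\<close>

lemma chain_map_exists:
  assumes S: "cring S" and N: "module S N"
    and F: "free_resolution S N \<beta> d \<epsilon>" and G: "free_resolution S N \<beta>' d' \<epsilon>'"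
  obtains f where "\<And>i. f i \<in> module_hom S (free_module S (\<beta> i)) (free_module S (\<beta>' i))"
    "\<And>u. u \<in> carrier (free_module S (\<beta> 0)) \<Longrightarrow> \<epsilon>' (f 0 u) = \<epsilon> u"
    "\<And>i u. u \<in> carrier (free_module S (\<beta> (Suc i))) \<Longrightarrow> d' i (f (Suc i) u) = f i (d i u)"
proof -
  let ?F = "\<lambda>i. free_module S (\<beta> i)" and ?G = "\<lambda>i. free_module S (\<beta>' i)"
  note FM = free_module_is_module[OF S]
  note F = resolution_exactness[OF F] and G = resolution_exactness[OF G]
  define P where "P = (\<lambda>i f. f \<in> module_hom S (?F i) (?G i) \<and>
    f ` d i ` carrier (?F (Suc i)) \<subseteq> d' i ` carrier (?G (Suc i)) \<and>
    (i = 0 \<longrightarrow> (\<forall>u\<in>carrier (?F 0). \<epsilon>' (f u) = \<epsilon> u)))"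
  define Q where "Q = (\<lambda>i f g. \<forall>u\<in>carrier (?F (Suc i)). d' i (g u) = f (d i u))"
  have "\<exists>f. \<forall>i. P i (f i) \<and> Q i (f i) (f (Suc i))"
  proof (rule dependent_nat_choice)
    obtain f where f: "f \<in> module_hom S (?F 0) (?G 0)" "\<And>u. u \<in> carrier (?F 0) \<Longrightarrow> \<epsilon>' (f u) = \<epsilon> u"
    proof (rule free_module_lift[OF S N FM F(1) G(1)])
      show "\<epsilon> ` carrier (?F 0) \<subseteq> \<epsilon>' ` carrier (?G 0)" using F(3) G(3) by simp
    qed (use that in blast)
    have "f ` d 0 ` carrier (?F 1) \<subseteq> d' 0 ` carrier (?G 1)"
      unfolding F(4) G(4) using f module_hom_closed[OF f(1)] by auto
    then show "\<exists>f. P 0 f" unfolding P_def using f by auto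
  next
    fix f i assume P: "P i f"
    then have f: "f \<in> module_hom S (?F i) (?G i)"
      and sub: "f ` d i ` carrier (?F (Suc i)) \<subseteq> d' i ` carrier (?G (Suc i))" by (auto simp: P_def)
    obtain g where g: "g \<in> module_hom S (?F (Suc i)) (?G (Suc i))"
      "\<And>u. u \<in> carrier (?F (Suc i)) \<Longrightarrow> d' i (g u) = f (d i u)"
    proof (rule free_module_lift[OF S FM FM module_hom_comp[OF F(2) f] G(2)])
      show "(\<lambda>u. f (d i u)) ` carrier (?F (Suc i)) \<subseteq> d' i ` carrier (?G (Suc i))"
        using sub by (simp add: image_image)
    qed (use that in blast)
    have "g ` d (Suc i) ` carrier (?F (Suc (Suc i))) \<subseteq> d' (Suc i) ` carrier (?G (Suc (Suc i)))"
      unfolding F(5) G(5) using g module_hom_closed[OF g(1)] module_hom_zero[OF FM FM f] by auto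
    then have "P (Suc i) g" "Q i f g" unfolding P_def Q_def using g by auto
    then show "\<exists>g. P (Suc i) g \<and> Q i f g" by blast
  qed
  then obtain f where f: "\<And>i. P i (f i)" "\<And>i. Q i (f i) (f (Suc i))" by blast
  show thesis
  proof (rule that)
    show "f i \<in> module_hom S (?F i) (?G i)" for i using f(1)[of i] by (simp add: P_def)
    show "\<epsilon>' (f 0 u) = \<epsilon> u" if "u \<in> carrier (?F 0)" for u using f(1)[of 0] that by (simp add: P_def)
    show "d' i (f (Suc i) u) = f i (d i u)" if "u \<in> carrier (?F (Suc i))" for i u
      using f(2)[of i] that by (simp add: Q_def)
  qed
qed

text \<open>
  A chain endomorphism that lifts the zero map is null-homotopic. The construction in degree \<open>i + 1\<close>
  needs \<open>d h d = \<phi> d\<close> in degree \<open>i\<close>, which makes \<open>\<phi> - h d\<close> take values in cycles.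
\<close>

lemma null_homotopy_exists:
  assumes S: "cring S" and N: "module S N" and F: "free_resolution S N \<beta> d \<epsilon>"
    and \<phi>: "\<And>i. \<phi> i \<in> module_hom S (free_module S (\<beta> i)) (free_module S (\<beta> i))"
    and \<phi>0: "\<And>u. u \<in> carrier (free_module S (\<beta> 0)) \<Longrightarrow> \<epsilon> (\<phi> 0 u) = \<zero>\<^bsub>N\<^esub>"
    and \<phi>d: "\<And>i u. u \<in> carrier (free_module S (\<beta> (Suc i))) \<Longrightarrow> d i (\<phi> (Suc i) u) = \<phi> i (d i u)"
  obtains h where "\<And>i. h i \<in> module_hom S (free_module S (\<beta> i)) (free_module S (\<beta> (Suc i)))"
    "\<And>u. u \<in> carrier (free_module S (\<beta> 0)) \<Longrightarrow> \<phi> 0 u = d 0 (h 0 u)"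
    "\<And>i u. u \<in> carrier (free_module S (\<beta> (Suc i))) \<Longrightarrow>
       \<phi> (Suc i) u = d (Suc i) (h (Suc i) u) \<oplus>\<^bsub>free_module S (\<beta> (Suc i))\<^esub> h i (d i u)"
proof -
  let ?F = "\<lambda>i. free_module S (\<beta> i)"
  note FM = free_module_is_module[OF S]
  note F = resolution_exactness[OF F]
  define P where "P = (\<lambda>i h. h \<in> module_hom S (?F i) (?F (Suc i)) \<and>
    (\<forall>u\<in>carrier (?F (Suc i)). d i (h (d i u)) = \<phi> i (d i u)) \<and>
    (i = 0 \<longrightarrow> (\<forall>u\<in>carrier (?F 0). d 0 (h u) = \<phi> 0 u)))"
  define Q where "Q = (\<lambda>i h h'. \<forall>u\<in>carrier (?F (Suc i)).
    d (Suc i) (h' u) = \<phi> (Suc i) u \<ominus>\<^bsub>?F (Suc i)\<^esub> h (d i u))"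
  have dc: "d i u \<in> carrier (?F i)" if "u \<in> carrier (?F (Suc i))" for i u
    using module_hom_closed[OF F(2) that] .
  have \<phi>c: "\<phi> i u \<in> carrier (?F i)" if "u \<in> carrier (?F i)" for i u
    using module_hom_closed[OF \<phi> that] .
  have "\<exists>h. \<forall>i. P i (h i) \<and> Q i (h i) (h (Suc i))"
  proof (rule dependent_nat_choice)
    obtain h where h: "h \<in> module_hom S (?F 0) (?F (Suc 0))" "\<And>u. u \<in> carrier (?F 0) \<Longrightarrow> d 0 (h u) = \<phi> 0 u"
    proof (rule free_module_lift[OF S FM FM \<phi> F(2)])
      show "\<phi> 0 ` carrier (?F 0) \<subseteq> d 0 ` carrier (?F (Suc 0))"
        unfolding F(4)[unfolded One_nat_def] using \<phi>0 \<phi>c by blast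
    qed (use that in blast)
    then show "\<exists>h. P 0 h" unfolding P_def using dc by blast
  next
    fix h i assume P: "P i h"
    then have h: "h \<in> module_hom S (?F i) (?F (Suc i))"
      and dhd: "\<And>u. u \<in> carrier (?F (Suc i)) \<Longrightarrow> d i (h (d i u)) = \<phi> i (d i u)" by (auto simp: P_def)
    interpret Fi: module S "?F i" by (rule FM)
    interpret Fi1: module S "?F (Suc i)" by (rule FM)
    note hd = module_hom_comp[OF F(2) h]
    let ?\<psi> = "\<lambda>u. \<phi> (Suc i) u \<ominus>\<^bsub>?F (Suc i)\<^esub> h (d i u)"
    have \<psi>: "?\<psi> \<in> module_hom S (?F (Suc i)) (?F (Suc i))"
      by (rule module_hom_diff[OF FM FM \<phi> hd])
    have d\<psi>: "d i (?\<psi> u) = \<zero>\<^bsub>?F i\<^esub>" if u: "u \<in> carrier (?F (Suc i))" for u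
    proof -
      have c: "\<phi> (Suc i) u \<in> carrier (?F (Suc i))" "h (d i u) \<in> carrier (?F (Suc i))"
        using \<phi>c[OF u] module_hom_closed[OF hd u] by auto
      have "?\<psi> u \<oplus>\<^bsub>?F (Suc i)\<^esub> h (d i u) = \<phi> (Suc i) u"
        using c Fi1.a_assoc[of "\<phi> (Suc i) u" "\<ominus>\<^bsub>?F (Suc i)\<^esub> h (d i u)" "h (d i u)"] Fi1.l_neg[OF c(2)] Fi1.r_zero[OF c(1)]
        by (simp add: Fi1.minus_eq del: free_module_simps)
      then have "d i (\<phi> (Suc i) u) = d i (?\<psi> u) \<oplus>\<^bsub>?F i\<^esub> d i (h (d i u))"
        using module_hom_add[OF F(2) module_hom_closed[OF \<psi> u] c(2)] by (metis (no_types))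
      then have "\<phi> i (d i u) = d i (?\<psi> u) \<oplus>\<^bsub>?F i\<^esub> \<phi> i (d i u)"
        using \<phi>d[OF u] dhd[OF u] by simp
      then show ?thesis
        using Fi.add.r_cancel_one'[of "\<phi> i (d i u)" "d i (?\<psi> u)"] dc[OF module_hom_closed[OF \<psi> u]] \<phi>c[OF dc[OF u]]
        by (simp del: free_module_simps)
    qed
    obtain h' where h': "h' \<in> module_hom S (?F (Suc i)) (?F (Suc (Suc i)))"
      "\<And>u. u \<in> carrier (?F (Suc i)) \<Longrightarrow> d (Suc i) (h' u) = ?\<psi> u"
    proof (rule free_module_lift[OF S FM FM \<psi> F(2)])
      show "?\<psi> ` carrier (?F (Suc i)) \<subseteq> d (Suc i) ` carrier (?F (Suc (Suc i)))"
        unfolding F(5) using module_hom_closed[OF \<psi>] d\<psi> by blast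
    qed (use that in blast)
    have "d (Suc i) (h' (d (Suc i) u)) = \<phi> (Suc i) (d (Suc i) u)" if u: "u \<in> carrier (?F (Suc (Suc i)))" for u
    proof -
      have z: "d i (d (Suc i) u) = \<zero>\<^bsub>?F i\<^esub>" using F(5)[of i] u by blast
      have c: "\<phi> (Suc i) (d (Suc i) u) \<in> carrier (?F (Suc i))" using \<phi>c dc u by blast
      show ?thesis
        unfolding h'(2)[OF dc[OF u]] z module_hom_zero[OF FM FM h]
        using c by (simp add: Fi1.minus_eq del: free_module_simps)
    qed
    then have "P (Suc i) h'" "Q i h h'" unfolding P_def Q_def using h' by auto
    then show "\<exists>h'. P (Suc i) h' \<and> Q i h h'" by blast
  qed
  then obtain h where h: "\<And>i. P i (h i)" "\<And>i. Q i (h i) (h (Suc i))" by blast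
  show thesis
  proof (rule that)
    show hh: "h i \<in> module_hom S (?F i) (?F (Suc i))" for i using h(1)[of i] by (simp add: P_def)
    show "\<phi> 0 u = d 0 (h 0 u)" if "u \<in> carrier (?F 0)" for u using h(1)[of 0] that by (simp add: P_def)
    show "\<phi> (Suc i) u = d (Suc i) (h (Suc i) u) \<oplus>\<^bsub>?F (Suc i)\<^esub> h i (d i u)"
      if u: "u \<in> carrier (?F (Suc i))" for i u
    proof -
      interpret Fi1: module S "?F (Suc i)" by (rule FM)
      have c: "\<phi> (Suc i) u \<in> carrier (?F (Suc i))" "h i (d i u) \<in> carrier (?F (Suc i))"
        using \<phi>c[OF u] module_hom_closed[OF hh dc[OF u]] by auto
      have "d (Suc i) (h (Suc i) u) = \<phi> (Suc i) u \<ominus>\<^bsub>?F (Suc i)\<^esub> h i (d i u)"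
        using h(2)[of i] u by (simp add: Q_def)
      then show ?thesis
        using c Fi1.a_assoc[of "\<phi> (Suc i) u" "\<ominus>\<^bsub>?F (Suc i)\<^esub> h i (d i u)" "h i (d i u)"] Fi1.l_neg[OF c(2)] Fi1.r_zero[OF c(1)]
        by (simp add: Fi1.minus_eq del: free_module_simps)
    qed
  qed
qed

text \<open>
  Let \<open>f\<close> and \<open>g\<close> be comparison maps in the two directions. Then \<open>g f - 1\<close> is null-homotopic, hence of
  the form \<open>d h + h d\<close>, and it takes values in \<open>m F\<close> because \<open>d\<close> does. So \<open>f\<close> has a left inverse modulo
  \<open>m\<close>, and ranks compare as dimensions over \<open>S/m\<close>.
\<close>

lemma minimal_free_resolution_rank_le:
  assumes S: "cring S" and m: "maximalideal m S" and N: "module S N"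
    and Fm: "minimal_free_resolution S m N \<beta> d \<epsilon>" and G: "free_resolution S N \<beta>' d' \<epsilon>'"
  shows "\<beta> i \<le> \<beta>' i"
proof -
  let ?F = "\<lambda>i. free_module S (\<beta> i)" and ?G = "\<lambda>i. free_module S (\<beta>' i)"
  note FM = free_module_is_module[OF S]
  interpret cring S by fact
  interpret m: maximalideal m S by fact
  have Fr: "free_resolution S N \<beta> d \<epsilon>"
    and dm: "\<And>i u. u \<in> carrier (?F (Suc i)) \<Longrightarrow> d i u \<in> {..<\<beta> i} \<rightarrow>\<^sub>E m"
    using Fm unfolding minimal_free_resolution_def by blast+
  note F = resolution_exactness[OF Fr]
  interpret N: module S N by fact
  obtain f where f: "\<And>i. f i \<in> module_hom S (?F i) (?G i)"
    "\<And>u. u \<in> carrier (?F 0) \<Longrightarrow> \<epsilon>' (f 0 u) = \<epsilon> u"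
    "\<And>i u. u \<in> carrier (?F (Suc i)) \<Longrightarrow> d' i (f (Suc i) u) = f i (d i u)"
    using chain_map_exists[OF S N Fr G] by blast
  obtain g where g: "\<And>i. g i \<in> module_hom S (?G i) (?F i)"
    "\<And>u. u \<in> carrier (?G 0) \<Longrightarrow> \<epsilon> (g 0 u) = \<epsilon>' u"
    "\<And>i u. u \<in> carrier (?G (Suc i)) \<Longrightarrow> d i (g (Suc i) u) = g i (d' i u)"
    using chain_map_exists[OF S N G Fr] by blast
  have gf: "(\<lambda>u. g i (f i u)) \<in> module_hom S (?F i) (?F i)" for i
    by (rule module_hom_comp[OF f(1) g(1)])
  define \<phi> where "\<phi> = (\<lambda>i u. g i (f i u) \<ominus>\<^bsub>?F i\<^esub> u)"
  have \<phi>: "\<phi> i \<in> module_hom S (?F i) (?F i)" for i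
    unfolding \<phi>_def by (rule module_hom_diff[OF FM FM gf module_hom_id[OF FM]])
  have hom_minus: "h (v \<ominus>\<^bsub>?F i\<^esub> w) = h v \<ominus>\<^bsub>P\<^esub> h w"
    if h: "h \<in> module_hom S (?F i) P" and P: "module S P" and v: "v \<in> carrier (?F i)" and w: "w \<in> carrier (?F i)"
    for h i v w and P :: "('a, 'x, 'y) module_scheme"
  proof -
    interpret P: module S P by fact
    interpret Fi: module S "?F i" by (rule FM)
    have mw: "\<ominus>\<^bsub>?F i\<^esub> w = (\<ominus>\<^bsub>S\<^esub> \<one>\<^bsub>S\<^esub>) \<odot>\<^bsub>?F i\<^esub> w"
      using Fi.smult_l_minus[of "\<one>\<^bsub>S\<^esub>" w] w Fi.smult_one by (metis one_closed)
    have "h ((\<ominus>\<^bsub>S\<^esub> \<one>\<^bsub>S\<^esub>) \<odot>\<^bsub>?F i\<^esub> w) = (\<ominus>\<^bsub>S\<^esub> \<one>\<^bsub>S\<^esub>) \<odot>\<^bsub>P\<^esub> h w"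
      by (rule module_hom_smult[OF h _ w]) simp
    also have "\<dots> = \<ominus>\<^bsub>P\<^esub> h w"
      using P.smult_l_minus[of "\<one>\<^bsub>S\<^esub>" "h w"] module_hom_closed[OF h w] by simp
    finally have "h (\<ominus>\<^bsub>?F i\<^esub> w) = \<ominus>\<^bsub>P\<^esub> h w" by (simp only: mw)
    then show ?thesis
      unfolding Fi.minus_eq P.minus_eq using module_hom_add[OF h v, of "\<ominus>\<^bsub>?F i\<^esub> w"] Fi.a_inv_closed[OF w] by simp
  qed
  obtain h where h: "\<And>i. h i \<in> module_hom S (?F i) (?F (Suc i))"
    "\<And>u. u \<in> carrier (?F 0) \<Longrightarrow> \<phi> 0 u = d 0 (h 0 u)"
    "\<And>i u. u \<in> carrier (?F (Suc i)) \<Longrightarrow>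
       \<phi> (Suc i) u = d (Suc i) (h (Suc i) u) \<oplus>\<^bsub>?F (Suc i)\<^esub> h i (d i u)"
  proof (rule null_homotopy_exists[OF S N Fr \<phi>])
    show "\<epsilon> (\<phi> 0 u) = \<zero>\<^bsub>N\<^esub>" if u: "u \<in> carrier (?F 0)" for u
    proof -
      have "\<epsilon> (\<phi> 0 u) = \<epsilon> u \<ominus>\<^bsub>N\<^esub> \<epsilon> u"
        unfolding \<phi>_def hom_minus[OF F(1) N module_hom_closed[OF gf u] u]
        using g(2)[OF module_hom_closed[OF f(1) u]] f(2)[OF u] by simp
      then show ?thesis
        using module_hom_closed[OF F(1) u] by (simp add: N.minus_eq N.r_neg)
    qed
    show "d i (\<phi> (Suc i) u) = \<phi> i (d i u)" if u: "u \<in> carrier (?F (Suc i))" for i u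
      unfolding \<phi>_def hom_minus[OF F(2) FM module_hom_closed[OF gf u] u]
      using g(3)[OF module_hom_closed[OF f(1) u]] f(3)[OF u] by simp
  qed (use that in blast)
  have "\<phi> i u \<in> {..<\<beta> i} \<rightarrow>\<^sub>E m" if u: "u \<in> carrier (?F i)" for i u
  proof (cases i)
    case 0
    then show ?thesis using h(2) dm[OF module_hom_closed[OF h(1)], of u 0] u by simp
  next
    case (Suc j)
    have "d (Suc j) (h (Suc j) u) \<in> {..<\<beta> (Suc j)} \<rightarrow>\<^sub>E m"
      using dm[OF module_hom_closed[OF h(1)], of u "Suc j"] u Suc by simp
    moreover have "h j (d j u) \<in> {..<\<beta> (Suc j)} \<rightarrow>\<^sub>E m"
      using module_hom_ideal_vectors[OF S m.is_ideal h(1) dm] u Suc by simp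
    ultimately show ?thesis
      using h(3)[of u j] u Suc by (auto simp: PiE_def Pi_iff m.a_closed)
  qed
  then show ?thesis
    using rank_le_if_left_inverse_mod_maximalideal[OF S m f(1) g(1)] by (simp add: \<phi>_def)
qed

theorem betti_number_eq:
  assumes "cring S" "maximalideal m S" "module S N" "minimal_free_resolution S m N \<beta> d \<epsilon>"
  shows "betti_number S m N i = \<beta> i"
  unfolding betti_number_def
proof (rule the_equality)
  show "\<exists>\<beta>' d \<epsilon>. minimal_free_resolution S m N \<beta>' d \<epsilon> \<and> \<beta>' i = \<beta> i" using assms(4) by blast
  fix n assume "\<exists>\<beta> d \<epsilon>. minimal_free_resolution S m N \<beta> d \<epsilon> \<and> \<beta> i = n"
  then obtain \<beta>' d' \<epsilon>' where 1: "minimal_free_resolution S m N \<beta>' d' \<epsilon>'" "\<beta>' i = n" by blast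
  then show "n = \<beta> i"
    using minimal_free_resolution_rank_le[OF assms(1-3)] assms(4)
    by (metis le_antisym minimal_free_resolution_def)
qed

section \<open>Minimal free resolutions over a quotient ring\<close>

lemma ring_of_type_algebra_simps [simp]:
  "carrier ring_of_type_algebra = UNIV"
  "\<zero>\<^bsub>ring_of_type_algebra\<^esub> = 0" "\<one>\<^bsub>ring_of_type_algebra\<^esub> = 1"
  "a \<oplus>\<^bsub>ring_of_type_algebra\<^esub> b = a + b" "a \<otimes>\<^bsub>ring_of_type_algebra\<^esub> b = a * b"
  by (simp_all add: ring_of_type_algebra_def)

lemma ring_of_type_algebra_minus [simp]:
  fixes a b :: "'a::comm_ring_1"
  shows "\<ominus>\<^bsub>ring_of_type_algebra\<^esub> a = - a" "a \<ominus>\<^bsub>ring_of_type_algebra\<^esub> b = a - b"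
proof -
  interpret cring "ring_of_type_algebra :: 'a ring" ..
  show "\<ominus>\<^bsub>ring_of_type_algebra\<^esub> a = - a" using minus_equality[of "- a" a] by simp
  then show "a \<ominus>\<^bsub>ring_of_type_algebra\<^esub> b = a - b" by (simp add: minus_eq) (metis minus_equality UNIV_I add.left_inverse ring_of_type_algebra_simps add_uminus_conv_diff)
qed

lemma ideal_of_type_algebraI:
  fixes I :: "'a::comm_ring_1 set"
  assumes "0 \<in> I" "\<And>u v. u \<in> I \<Longrightarrow> v \<in> I \<Longrightarrow> u + v \<in> I" "\<And>c u. u \<in> I \<Longrightarrow> c * u \<in> I"
  shows "ideal I ring_of_type_algebra"
proof -
  interpret cring "ring_of_type_algebra :: 'a ring" ..
  have "- u \<in> I" if "u \<in> I" for u using assms(3)[OF that, of "-1"] by simp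
  then have "subgroup I (add_monoid (ring_of_type_algebra :: 'a ring))"
    using assms by (intro add.subgroupI) (auto simp: a_inv_def[symmetric])
  then show ?thesis
    using assms(3) by (intro idealI) (auto simp: mult.commute ring_axioms)
qed

lemma ideal_of_type_algebraD:
  fixes I :: "'a::comm_ring_1 set"
  assumes "ideal I ring_of_type_algebra"
  shows "0 \<in> I" "\<And>u v. u \<in> I \<Longrightarrow> v \<in> I \<Longrightarrow> u + v \<in> I" "\<And>c u. u \<in> I \<Longrightarrow> c * u \<in> I"
    "\<And>u v. u \<in> I \<Longrightarrow> v \<in> I \<Longrightarrow> u - v \<in> I"
proof -
  interpret ideal I ring_of_type_algebra by fact
  show "0 \<in> I" using additive_subgroup.zero_closed[OF additive_subgroup_axioms] by simp
  show add: "u + v \<in> I" if "u \<in> I" "v \<in> I" for u v using additive_subgroup.a_closed[OF additive_subgroup_axioms that] by simp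
  show mult: "c * u \<in> I" if "u \<in> I" for c u using I_l_closed[OF that, of c] by simp
  show "u - v \<in> I" if "u \<in> I" "v \<in> I" for u v using add[OF that(1) mult[OF that(2), of "-1"]] by simp
qed

lemma carrier_FactRing: "carrier (R Quot I) = (\<lambda>a. I +>\<^bsub>R\<^esub> a) ` carrier R"
  by (auto simp: FactRing_def A_RCOSETS_def')

lemma quotient_module_simps:
  "carrier (quotient_module S I) = carrier (S Quot I)"
  "add (quotient_module S I) = add (S Quot I)" "ring.zero (quotient_module S I) = ring.zero (S Quot I)"
  "module.smult (quotient_module S I) = (\<lambda>s c. (I +>\<^bsub>S\<^esub> s) \<otimes>\<^bsub>S Quot I\<^esub> c)"
  by (simp_all add: quotient_module_def ring.defs)

text \<open>
  Computations in the quotient ring \<open>S = R/M\<close> are replaced by computations in \<open>R\<close> modulo \<open>M\<close>, where the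
  ring is a type, and bases may be any finite sets \<open>W n\<close> instead of initial segments of the natural
  numbers. A function \<open>U\<close> on the basis with values in \<open>R\<close> represents the vector \<open>vec n U\<close> over \<open>S\<close>, and
  the differential is the well-defined map sending \<open>vec (n + 1) U\<close> to \<open>vec n (D U)\<close>. One
  operator \<open>D\<close> serves all degrees, as the degree can be read off the basis element at
  which it is evaluated.
\<close>

lemma minimal_free_resolution_quotient:
  fixes M m0 :: "'a::comm_ring_1 set" and W :: "nat \<Rightarrow> 'w set" and D :: "('w \<Rightarrow> 'a) \<Rightarrow> 'w \<Rightarrow> 'a"
  defines "S \<equiv> ring_of_type_algebra Quot M"
  defines "m \<equiv> (\<lambda>a. M +>\<^bsub>ring_of_type_algebra\<^esub> a) ` m0"
  assumes M: "ideal M ring_of_type_algebra" and m0: "ideal m0 ring_of_type_algebra" "M \<subseteq> m0" and m: "ideal m S"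
    and fin: "\<And>n. finite (W n)" and W0: "W 0 = {base}"
    and D_add: "\<And>u v w. D (\<lambda>w. u w + v w) w = D u w + D v w"
    and D_scale: "\<And>c u w. D (\<lambda>w. c * u w) w = c * D u w"
    and D_M: "\<And>n u w. w \<in> W n \<Longrightarrow> (\<And>w'. w' \<in> W (Suc n) \<Longrightarrow> u w' \<in> M) \<Longrightarrow> D u w \<in> M"
    and D_m: "\<And>n u w. w \<in> W n \<Longrightarrow> D u w \<in> m0"
    and DD: "\<And>n u w. w \<in> W n \<Longrightarrow> D (D u) w \<in> M"
    and exact: "\<And>n u. \<forall>w\<in>W n. D u w \<in> M \<Longrightarrow> \<exists>v. \<forall>w\<in>W (Suc n). u w - D v w \<in> M"
    and aug: "\<And>f. f \<in> m0 \<Longrightarrow> \<exists>u. f - D u base \<in> M"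
  obtains d \<epsilon> where "minimal_free_resolution S m (quotient_module S m) (\<lambda>n. card (W n)) d \<epsilon>"
proof -
  let ?R = "ring_of_type_algebra :: 'a ring"
  interpret R: cring ?R ..
  interpret M: ideal M ?R by fact
  interpret S: cring S unfolding S_def by (rule M.quotient_is_cring[OF R.cring_axioms])
  interpret m: ideal m S by fact
  define \<pi> where "\<pi> = (\<lambda>a. M +>\<^bsub>?R\<^esub> a)"
  have \<pi>hom: "\<pi> \<in> ring_hom ?R S" unfolding \<pi>_def S_def by (rule M.rcos_ring_hom)
  have \<pi>c: "\<pi> a \<in> carrier S" for a using ring_hom_closed[OF \<pi>hom] by simp
  have \<pi>_add: "\<pi> (a + b) = \<pi> a \<oplus>\<^bsub>S\<^esub> \<pi> b" for a b using ring_hom_add[OF \<pi>hom, of a b] by simp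
  have \<pi>_mult: "\<pi> (a * b) = \<pi> a \<otimes>\<^bsub>S\<^esub> \<pi> b" for a b using ring_hom_mult[OF \<pi>hom, of a b] by simp
  have \<pi>_eq: "\<pi> a = \<pi> b \<longleftrightarrow> a - b \<in> M" for a b
    using R.quotient_eq_iff_same_a_r_cos[OF M, of a b] by (simp add: \<pi>_def)
  have \<pi>0: "\<pi> 0 = \<zero>\<^bsub>S\<^esub>"
    unfolding \<pi>_def S_def FactRing_def using R.a_rcos_zero[OF M, of 0] ideal_of_type_algebraD(1)[OF M] by simp
  have \<pi>_surj: "\<exists>a. \<pi> a = s" if "s \<in> carrier S" for s
    using that unfolding S_def carrier_FactRing \<pi>_def by auto
  have \<pi>_m: "\<pi> f \<in> m \<longleftrightarrow> f \<in> m0" for f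
  proof
    assume "\<pi> f \<in> m"
    then obtain f' where f': "f' \<in> m0" "\<pi> f = \<pi> f'" unfolding m_def \<pi>_def by auto
    then have "f - f' \<in> m0" using \<pi>_eq m0(2) by blast
    then have "(f - f') + f' \<in> m0" using ideal_of_type_algebraD(2)[OF m0(1)] f'(1) by blast
    then show "f \<in> m0" by simp
  qed (auto simp: m_def \<pi>_def)
  have "\<exists>e. bij_betw e {..<card (W n)} (W n)" for n
    using ex_bij_betw_nat_finite[OF fin] by (simp add: atLeast0LessThan)
  then obtain e where e: "\<And>n. bij_betw (e n) {..<card (W n)} (W n)" by metis
  have eW: "e n j \<in> W n" if "j < card (W n)" for n j using e[of n] that by (auto simp: bij_betw_def)
  have eE: "\<exists>j<card (W n). e n j = w" if "w \<in> W n" for n w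
    using e[of n] that by (metis bij_betw_def imageE lessThan_iff)
  define vec where "vec = (\<lambda>n U. \<lambda>j\<in>{..<card (W n)}. \<pi> (U (e n j)))"
  let ?F = "\<lambda>n. free_module S (card (W n))"
  have vec_closed: "vec n U \<in> carrier (?F n)" for n U by (simp add: vec_def \<pi>c)
  have vec_nth: "vec n U j = \<pi> (U (e n j))" if "j < card (W n)" for n U j using that by (simp add: vec_def)
  have vec_eq: "vec n U = vec n V \<longleftrightarrow> (\<forall>w\<in>W n. U w - V w \<in> M)" for n U V
  proof
    assume eq: "vec n U = vec n V"
    show "\<forall>w\<in>W n. U w - V w \<in> M"
    proof
      fix w assume "w \<in> W n"
      then obtain j where "j < card (W n)" "e n j = w" using eE by blast
      then show "U w - V w \<in> M" using fun_cong[OF eq, of j] by (simp add: vec_nth \<pi>_eq)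
    qed
  next
    assume "\<forall>w\<in>W n. U w - V w \<in> M"
    then have "\<pi> (U (e n j)) = \<pi> (V (e n j))" if "j < card (W n)" for j
      using eW[OF that] by (simp add: \<pi>_eq)
    then show "vec n U = vec n V" unfolding vec_def by (intro restrict_ext) simp
  qed
  have vec_surj: "\<exists>U. vec n U = u" if u: "u \<in> carrier (?F n)" for n u
  proof -
    define U where "U = (\<lambda>w. SOME a. \<pi> a = u (inv_into {..<card (W n)} (e n) w))"
    have "\<pi> (U (e n j)) = u j" if j: "j < card (W n)" for j
    proof -
      have "inv_into {..<card (W n)} (e n) (e n j) = j"
        using e[of n] j by (intro inv_into_f_f) (auto simp: bij_betw_def)
      moreover have "\<exists>a. \<pi> a = u j" using u j by (intro \<pi>_surj) auto
      ultimately show ?thesis unfolding U_def by (metis (mono_tags) someI_ex)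
    qed
    then have "vec n U = u" using u by (intro PiE_ext[of _ "{..<card (W n)}" "\<lambda>_. carrier S"]) (auto simp: vec_def \<pi>c)
    then show ?thesis by blast
  qed
  have vec_add: "vec n U \<oplus>\<^bsub>?F n\<^esub> vec n V = vec n (\<lambda>w. U w + V w)" for n U V
    unfolding free_module_simps vec_def by (rule restrict_ext) (simp add: \<pi>_add)
  have vec_smult: "\<pi> c \<odot>\<^bsub>?F n\<^esub> vec n U = vec n (\<lambda>w. c * U w)" for n c U
    unfolding free_module_simps vec_def by (rule restrict_ext) (simp add: \<pi>_mult)
  have vec_0: "\<zero>\<^bsub>?F n\<^esub> = vec n (\<lambda>_. 0)" for n by (auto simp: vec_def \<pi>0)
  have D_add': "D (\<lambda>w. u w + v w) = (\<lambda>w. D u w + D v w)"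
    and D_scale': "D (\<lambda>w. c * u w) = (\<lambda>w. c * D u w)" for c u v
    by (rule ext, rule D_add) (rule ext, rule D_scale)
  define d where "d = (\<lambda>n u. vec n (D (SOME U. vec (Suc n) U = u)))"
  have d_vec: "d n (vec (Suc n) U) = vec n (D U)" for n U
  proof -
    define V where "V = (SOME V. vec (Suc n) V = vec (Suc n) U)"
    have "vec (Suc n) V = vec (Suc n) U" 
      unfolding V_def by (rule someI[where P = "\<lambda>V. vec (Suc n) V = vec (Suc n) U"]) (rule refl)
    then have V: "\<forall>w\<in>W (Suc n). V w - U w \<in> M" by (simp add: vec_eq)
    have "D V w - D U w \<in> M" if "w \<in> W n" for w
    proof -
      have "D (\<lambda>w. V w + (-1) * U w) w \<in> M" using V by (intro D_M[OF that]) auto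
      then show ?thesis by (simp only: D_add D_scale) simp
    qed
    then have "vec n (D V) = vec n (D U)" by (simp add: vec_eq)
    then show ?thesis by (simp only: d_def V_def)
  qed
  have d_hom: "d n \<in> module_hom S (?F (Suc n)) (?F n)" for n
    unfolding module_hom_def
  proof (intro CollectI conjI ballI funcsetI)
    fix u assume "u \<in> carrier (?F (Suc n))"
    then obtain U where U: "u = vec (Suc n) U" using vec_surj by metis
    show "d n u \<in> carrier (?F n)" unfolding U d_vec by (rule vec_closed)
    {
      fix v assume "v \<in> carrier (?F (Suc n))"
      then obtain V where V: "v = vec (Suc n) V" using vec_surj by metis
      show "d n (u \<oplus>\<^bsub>?F (Suc n)\<^esub> v) = d n u \<oplus>\<^bsub>?F n\<^esub> d n v"
        unfolding U V vec_add d_vec by (simp only: D_add')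
    }
  next
    fix s u assume "s \<in> carrier S" "u \<in> carrier (?F (Suc n))"
    then obtain c U where U: "s = \<pi> c" "u = vec (Suc n) U" using vec_surj \<pi>_surj by metis
    show "d n (s \<odot>\<^bsub>?F (Suc n)\<^esub> u) = s \<odot>\<^bsub>?F n\<^esub> d n u"
      unfolding U vec_smult d_vec by (simp only: D_scale')
  qed
  let ?N = "quotient_module S m"
  define \<epsilon> where "\<epsilon> = (\<lambda>u::nat \<Rightarrow> 'a set. m +>\<^bsub>S\<^esub> u 0)"
  have e0: "card (W 0) = 1" "e 0 0 = base" using W0 eW[of 0 0] by auto
  have \<epsilon>_vec: "\<epsilon> (vec 0 U) = m +>\<^bsub>S\<^esub> \<pi> (U base)" for U
    unfolding \<epsilon>_def using e0 by (simp add: vec_nth)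
  have \<epsilon>_hom: "\<epsilon> \<in> module_hom S (?F 0) ?N"
    unfolding module_hom_def quotient_module_simps
  proof (intro CollectI conjI ballI funcsetI)
    have nth: "u 0 \<in> carrier S" if "u \<in> carrier (?F 0)" for u
      using that e0(1) by (auto simp: PiE_def Pi_iff)
    show "\<epsilon> u \<in> carrier (S Quot m)" if "u \<in> carrier (?F 0)" for u
      unfolding \<epsilon>_def by (rule ring_hom_closed[OF m.rcos_ring_hom nth[OF that]])
    show "\<epsilon> (u \<oplus>\<^bsub>?F 0\<^esub> v) = \<epsilon> u \<oplus>\<^bsub>S Quot m\<^esub> \<epsilon> v" if "u \<in> carrier (?F 0)" "v \<in> carrier (?F 0)" for u v
      unfolding \<epsilon>_def using ring_hom_add[OF m.rcos_ring_hom nth nth] that e0(1) by simp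
    show "\<epsilon> (s \<odot>\<^bsub>?F 0\<^esub> u) = (m +>\<^bsub>S\<^esub> s) \<otimes>\<^bsub>S Quot m\<^esub> \<epsilon> u" if "s \<in> carrier S" "u \<in> carrier (?F 0)" for s u
      unfolding \<epsilon>_def using ring_hom_mult[OF m.rcos_ring_hom that(1) nth] that e0(1) by simp
  qed
  have im_d: "d n ` carrier (?F (Suc n)) = {vec n (D U) |U. True}" for n
  proof -
    have "carrier (?F (Suc n)) = range (vec (Suc n))" using vec_surj vec_closed by blast
    then show ?thesis by (auto simp: image_image d_vec)
  qed
  have ker_d: "module_kernel (?F (Suc n)) (?F n) (d n) = {vec (Suc n) U |U. \<forall>w\<in>W n. D U w \<in> M}" for n
  proof -
    have "module_kernel (?F (Suc n)) (?F n) (d n) = {vec (Suc n) U |U. d n (vec (Suc n) U) = \<zero>\<^bsub>?F n\<^esub>}"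
      unfolding module_kernel_def using vec_surj vec_closed by blast
    then show ?thesis unfolding d_vec vec_0 vec_eq by simp
  qed
  have \<epsilon>0: "\<epsilon> (vec 0 U) = \<zero>\<^bsub>?N\<^esub> \<longleftrightarrow> U base \<in> m0" for U
    unfolding \<epsilon>_vec quotient_module_simps FactRing_def
    using m.a_rcos_const m.rcos_const_imp_mem[OF \<pi>c, of "U base"] \<pi>_m[of "U base"] by auto
  have "free_resolution S ?N (\<lambda>n. card (W n)) d \<epsilon>"
    unfolding free_resolution_def Let_def
  proof (intro conjI allI)
    show "\<epsilon> \<in> module_hom S (?F 0) ?N" "\<And>i. d i \<in> module_hom S (?F (Suc i)) (?F i)"
      using \<epsilon>_hom d_hom by auto
    have "\<epsilon> (\<lambda>j\<in>{..<card (W 0)}. s) = m +>\<^bsub>S\<^esub> s" for s by (simp add: \<epsilon>_def e0)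
    moreover have "(\<lambda>j\<in>{..<card (W 0)}. s) \<in> carrier (?F 0)" if "s \<in> carrier S" for s using that by simp
    ultimately have "carrier ?N \<subseteq> \<epsilon> ` carrier (?F 0)"
      unfolding quotient_module_simps carrier_FactRing by (metis image_subsetI imageI)
    then show "\<epsilon> ` carrier (?F 0) = carrier ?N"
      using module_hom_closed[OF \<epsilon>_hom] by blast
    show "d 0 ` carrier (?F 1) = module_kernel (?F 0) ?N \<epsilon>"
    proof (intro equalityI subsetI)
      fix u assume "u \<in> d 0 ` carrier (?F 1)"
      then obtain U where U: "u = vec 0 (D U)" using im_d[of 0] by auto
      then show "u \<in> module_kernel (?F 0) ?N \<epsilon>"
        unfolding module_kernel_def U using vec_closed[of 0 "D U"] \<epsilon>0[of "D U"] D_m[of base 0 U] W0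
        by blast
    next
      fix u assume u: "u \<in> module_kernel (?F 0) ?N \<epsilon>"
      then obtain U where U: "u = vec 0 U" unfolding module_kernel_def using vec_surj by blast
      then have "U base \<in> m0" using u \<epsilon>0 by (simp add: module_kernel_def)
      then obtain V where "U base - D V base \<in> M" using aug by blast
      then have "u = vec 0 (D V)" unfolding U vec_eq W0 by simp
      then show "u \<in> d 0 ` carrier (?F 1)" using im_d[of 0] by auto
    qed
    show "d (Suc i) ` carrier (?F (Suc (Suc i))) = module_kernel (?F (Suc i)) (?F i) (d i)" for i
      unfolding im_d ker_d
    proof (intro equalityI subsetI)
      fix u assume "u \<in> {vec (Suc i) (D U) |U. True}"
      then show "u \<in> {vec (Suc i) U |U. \<forall>w\<in>W i. D U w \<in> M}" using DD by blast
    next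
      fix u assume "u \<in> {vec (Suc i) U |U. \<forall>w\<in>W i. D U w \<in> M}"
      then obtain U where U: "u = vec (Suc i) U" "\<forall>w\<in>W i. D U w \<in> M" by blast
      from exact[OF U(2)] obtain V where "\<forall>w\<in>W (Suc i). U w - D V w \<in> M" by blast
      then have "u = vec (Suc i) (D V)" by (simp add: U vec_eq)
      then show "u \<in> {vec (Suc i) (D U) |U. True}" by blast
    qed
  qed
  moreover have "d i ` carrier (?F (Suc i)) \<subseteq> {..<card (W i)} \<rightarrow>\<^sub>E m" for i
    unfolding im_d using D_m[OF eW[of _ i]] by (auto simp: vec_def \<pi>_m)
  ultimately show thesis using that unfolding minimal_free_resolution_def by blast
qed

section \<open>A resolution with bases of words\<close>

text \<open>
  The basis elements of the resolution of \<open>C s\<close> for a state \<open>s\<close>. \<open>Stop\<close> and \<open>StepX\<close> are the generators in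
  degrees \<open>0\<close> and \<open>1\<close> of the complex \<open>S \<leftarrow> S\<close> given by \<open>x\<close>; \<open>Column l w\<close> is the element \<open>w\<close> of the
  resolution of the \<open>l\<close>-th summand of the annihilator of \<open>x\<close>, shifted by two; \<open>StepY w\<close> is the element
  \<open>w\<close> of the resolution of the kernel of \<open>S/xS \<rightarrow> C s\<close>, shifted by one.
\<close>

datatype word = Stop | StepX | Column nat word | StepY word

primrec word_degree :: "word \<Rightarrow> nat" where
  "word_degree Stop = 0"
| "word_degree StepX = 1"
| "word_degree (Column l w) = word_degree w + 2"
| "word_degree (StepY w) = word_degree w + 1"

lemma word_degree_eq_0_iff [simp]: "word_degree w = 0 \<longleftrightarrow> w = Stop"
  by (cases w) auto

text \<open>
  What the construction uses about the ring \<open>R\<close> and the ideal \<open>M\<close>. With \<open>S = R/M\<close>, a state \<open>s\<close> stands for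
  the module \<open>C s = S/(x, p s)\<close>. The assumptions say that the annihilator of \<open>x\<close> in \<open>S\<close> is the direct sum
  of the submodules \<open>g l S\<close>, each of them isomorphic to \<open>C (st l)\<close>, and that for a state with \<open>fin s\<close> the
  annihilator of \<open>p s\<close> in \<open>S/xS\<close> is generated by \<open>p (nxt s)\<close>, where \<open>nxt s\<close> is a state again. In the
  other states \<open>C s\<close> is \<open>S/xS\<close>.
\<close>

locale word_complex =
  fixes M :: "'a::comm_ring_1 set" and x :: 'a
    and L :: "nat set" and g :: "nat \<Rightarrow> 'a" and st :: "nat \<Rightarrow> 's"
    and States :: "'s set" and fin :: "'s \<Rightarrow> bool" and p :: "'s \<Rightarrow> 'a" and nxt :: "'s \<Rightarrow> 's"
  assumes M_zero: "0 \<in> M"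
    and M_add: "\<And>u v. u \<in> M \<Longrightarrow> v \<in> M \<Longrightarrow> u + v \<in> M"
    and M_mult: "\<And>c u. u \<in> M \<Longrightarrow> c * u \<in> M"
    and finite_L: "finite L"
    and st_States: "\<And>l. l \<in> L \<Longrightarrow> st l \<in> States"
    and nxt_States: "\<And>s. s \<in> States \<Longrightarrow> fin s \<Longrightarrow> nxt s \<in> States"
    and p_not_fin: "\<And>s. s \<in> States \<Longrightarrow> \<not> fin s \<Longrightarrow> p s = 0"
    and p_nxt: "\<And>s. s \<in> States \<Longrightarrow> fin s \<Longrightarrow> p s * p (nxt s) \<in> M"
    and x_g: "\<And>l. l \<in> L \<Longrightarrow> x * g l \<in> M"
    and g_p: "\<And>l. l \<in> L \<Longrightarrow> g l * p (st l) \<in> M"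
    and x_annihilates: "\<And>u. x * u \<in> M \<Longrightarrow> \<exists>v. u - (\<Sum>l\<in>L. g l * v l) \<in> M"
    and g_independent: "\<And>v l. (\<Sum>l\<in>L. g l * v l) \<in> M \<Longrightarrow> l \<in> L \<Longrightarrow> \<exists>c d. v l = x * c + p (st l) * d"
    and p_annihilates: "\<And>s u v. s \<in> States \<Longrightarrow> fin s \<Longrightarrow> x * u + p s * v \<in> M \<Longrightarrow> \<exists>c d. v = x * c + p (nxt s) * d"
begin

primrec valid :: "word \<Rightarrow> 's \<Rightarrow> bool" where
  "valid Stop s = True"
| "valid StepX s = True"
| "valid (Column l w) s = (l \<in> L \<and> valid w (st l))"
| "valid (StepY w) s = (fin s \<and> valid w (nxt s))"

definition words :: "'s \<Rightarrow> nat \<Rightarrow> word set" where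
  "words s n = {w. valid w s \<and> word_degree w = n}"

text \<open>
  The coefficient at the word \<open>w\<close> of the differential of \<open>u\<close>. Recursion on the target word \<open>w\<close> needs no
  sum over source words, apart from the one over \<open>L\<close>. The summand \<open>p s * u (StepY w)\<close> is the connecting
  chain map of the mapping cone, the sign in the last equation is that of the shifted complex. In
  states without a \<open>StepY\<close> the connecting summand vanishes because \<open>p s = 0\<close>.
\<close>

primrec boundary :: "word \<Rightarrow> 's \<Rightarrow> (word \<Rightarrow> 'a) \<Rightarrow> 'a" where
  "boundary Stop s u = x * u StepX + p s * u (StepY Stop)"
| "boundary StepX s u = (\<Sum>l\<in>L. g l * u (Column l Stop)) + p s * u (StepY StepX)"
| "boundary (Column l w) s u = boundary w (st l) (\<lambda>w'. u (Column l w')) + p s * u (StepY (Column l w))"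
| "boundary (StepY w) s u = - boundary w (nxt s) (\<lambda>w'. u (StepY w'))"

text \<open>
  The differential of the resolution of \<open>S/xS\<close>, which is the part of the mapping cone spanned by the
  words that do not begin with \<open>StepY\<close>.
\<close>

primrec x_boundary :: "word \<Rightarrow> (word \<Rightarrow> 'a) \<Rightarrow> 'a" where
  "x_boundary Stop u = x * u StepX"
| "x_boundary StepX u = (\<Sum>l\<in>L. g l * u (Column l Stop))"
| "x_boundary (Column l w) u = boundary w (st l) (\<lambda>w'. u (Column l w'))"
| "x_boundary (StepY w) u = 0"

definition x_word :: "word \<Rightarrow> bool" where
  "x_word w = (case w of StepY _ \<Rightarrow> False | _ \<Rightarrow> True)"

lemma x_word_simps [simp]: "x_word Stop" "x_word StepX" "x_word (Column l w)" "\<not> x_word (StepY w)"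
  by (auto simp: x_word_def)

lemma boundary_x_word: "x_word w \<Longrightarrow> boundary w s u = x_boundary w u + p s * u (StepY w)"
  by (cases w) auto

lemma boundary_add: "boundary w s (\<lambda>w. u w + v w) = boundary w s u + boundary w s v"
  by (induction w arbitrary: s u v) (auto simp: algebra_simps sum.distrib)

lemma boundary_scale: "boundary w s (\<lambda>w. c * u w) = c * boundary w s u"
  by (induction w arbitrary: s u) (auto simp: algebra_simps sum_distrib_left)

lemma x_boundary_add: "x_boundary w (\<lambda>w. u w + v w) = x_boundary w u + x_boundary w v"
  by (cases w) (auto simp: algebra_simps sum.distrib boundary_add)

lemma x_boundary_scale: "x_boundary w (\<lambda>w. c * u w) = c * x_boundary w u"
  by (cases w) (auto simp: algebra_simps sum_distrib_left boundary_scale)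

lemma x_boundary_cong: "(\<And>w. x_word w \<Longrightarrow> u w = v w) \<Longrightarrow> x_boundary w u = x_boundary w v"
  by (cases w) auto

lemma M_minus: "u \<in> M \<Longrightarrow> - u \<in> M"
  using M_mult[of u "-1"] by simp

lemma M_mult2: "u \<in> M \<Longrightarrow> u * c \<in> M"
  using M_mult[of u c] by (simp add: mult.commute)

lemma M_diff: "u \<in> M \<Longrightarrow> v \<in> M \<Longrightarrow> u - v \<in> M"
  using M_add[OF _ M_minus, of u v] by simp

lemma M_minus_iff [simp]: "- u \<in> M \<longleftrightarrow> u \<in> M"
  using M_minus[of u] M_minus[of "-u"] by auto

lemma M_sum: "(\<And>l. l \<in> A \<Longrightarrow> f l \<in> M) \<Longrightarrow> sum f A \<in> M"
  by (induction A rule: infinite_finite_induct) (auto simp: M_zero M_add)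

lemma p_term:
  assumes "s \<in> States" "fin s \<Longrightarrow> v \<in> M"
  shows "p s * v \<in> M"
  using assms p_not_fin[of s] M_mult[of v "p s"] M_zero by (cases "fin s") auto

text \<open>
  The differential is well defined modulo \<open>M\<close> and depends only on the values at valid words of the
  next degree.
\<close>

lemma boundary_in_M:
  assumes "s \<in> States" "valid w s" "\<And>w'. w' \<in> words s (Suc (word_degree w)) \<Longrightarrow> u w' \<in> M"
  shows "boundary w s u \<in> M"
  using assms
proof (induction w arbitrary: s u)
  case Stop
  have "x * u StepX \<in> M" "p s * u (StepY Stop) \<in> M"
    using Stop by (auto intro: M_mult p_term simp: words_def)
  then show ?case by (simp add: M_add)
next
  case StepX
  have "(\<Sum>l\<in>L. g l * u (Column l Stop)) \<in> M" "p s * u (StepY StepX) \<in> M"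
    using StepX by (auto intro!: M_sum intro: M_mult p_term simp: words_def)
  then show ?case by (simp add: M_add)
next
  case (Column l w)
  have "boundary w (st l) (\<lambda>w'. u (Column l w')) \<in> M"
    using Column by (auto intro!: Column.IH simp: words_def st_States)
  moreover have "p s * u (StepY (Column l w)) \<in> M"
    using Column by (auto intro: p_term simp: words_def)
  ultimately show ?case by (simp add: M_add)
next
  case (StepY w)
  then show ?case
    by (auto intro!: StepY.IH simp: words_def nxt_States)
qed

text \<open>
  Besides cancellation, three products of consecutive coefficients occur: \<open>x * g l\<close>, \<open>g l * p (st l)\<close> and
  \<open>p s * p (nxt s)\<close>, and all of them lie in \<open>M\<close>.
\<close>

lemma boundary_boundary:
  assumes "s \<in> States" "valid w s"
  shows "boundary w s (\<lambda>w. boundary w s u) \<in> M"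
  using assms
proof (induction w arbitrary: s u)
  case Stop
  have "x * (\<Sum>l\<in>L. g l * u (Column l Stop)) \<in> M"
    unfolding sum_distrib_left mult.assoc[symmetric] by (intro M_sum M_mult2 x_g)
  moreover have "p s * (p (nxt s) * u (StepY (StepY Stop))) \<in> M"
    using p_nxt[of s] M_mult2[of "p s * p (nxt s)" "u (StepY (StepY Stop))"] p_not_fin[of s] Stop M_zero
    by (cases "fin s") (auto simp: mult.assoc)
  ultimately have "x * (\<Sum>l\<in>L. g l * u (Column l Stop)) - p s * (p (nxt s) * u (StepY (StepY Stop))) \<in> M"
    by (rule M_diff)
  then show ?case by (simp add: algebra_simps)
next
  case StepX
  have 1: "(\<Sum>l\<in>L. x * g l * u (Column l StepX) + g l * p (st l) * u (Column l (StepY Stop))) \<in> M"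
    by (intro M_sum M_add M_mult2 x_g g_p)
  have 2: "p s * (p (nxt s) * u (StepY (StepY StepX))) \<in> M"
    using p_nxt[of s] M_mult2[of "p s * p (nxt s)" "u (StepY (StepY StepX))"] p_not_fin[of s] StepX M_zero
    by (cases "fin s") (auto simp: mult.assoc)
  have "boundary StepX s (\<lambda>w. boundary w s u) = (\<Sum>l\<in>L. x * g l * u (Column l StepX) + g l * p (st l) * u (Column l (StepY Stop)))
       - p s * (p (nxt s) * u (StepY (StepY StepX)))"
    by (simp add: algebra_simps sum.distrib sum_distrib_left)
  then show ?case using M_diff[OF 1 2] by simp
next
  case (Column l w)
  have 1: "boundary w (st l) (\<lambda>w'. boundary w' (st l) (\<lambda>w. u (Column l w))) \<in> M"
    using Column by (auto simp: st_States)
  have 2: "p s * (p (nxt s) * u (StepY (StepY (Column l w)))) \<in> M"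
    using p_nxt[of s] M_mult2[of "p s * p (nxt s)" "u (StepY (StepY (Column l w)))"] p_not_fin[of s] Column M_zero
    by (cases "fin s") (auto simp: mult.assoc)
  show ?case
    using M_diff[OF 1 2] by (simp add: boundary_add boundary_scale algebra_simps)
next
  case (StepY w)
  have "boundary w (nxt s) (\<lambda>w'. - 1 * boundary w' (nxt s) (\<lambda>w. u (StepY w))) \<in> M"
    unfolding boundary_scale using StepY by (intro M_mult StepY.IH) (auto simp: nxt_States)
  then show ?case by simp
qed

lemma words_0 [simp]: "words s 0 = {Stop}"
  by (auto simp: words_def)

definition exact_at :: "'s \<Rightarrow> nat \<Rightarrow> bool" where
  "exact_at s n \<longleftrightarrow> (\<forall>u. (\<forall>w\<in>words s n. boundary w s u \<in> M) \<longrightarrow>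
     (\<exists>v. \<forall>w\<in>words s (Suc n). u w - boundary w s v \<in> M))"

text \<open>
  The resolution of \<open>S/xS\<close> is spliced from multiplication by \<open>x\<close> and the resolutions of the summands of
  its annihilator: degree \<open>0\<close> is the statement that the \<open>g l\<close> generate the annihilator, degree \<open>1\<close> that
  their sum is direct with relations \<open>x\<close> and \<open>p (st l)\<close>, and higher degrees are inherited from lower
  degrees of the summands.
\<close>

lemma x_part_exact:
  assumes IH: "\<And>s m. s \<in> States \<Longrightarrow> m < n \<Longrightarrow> exact_at s m" and "s \<in> States"
    and u: "\<And>w. w \<in> words s n \<Longrightarrow> x_word w \<Longrightarrow> x_boundary w u \<in> M"
  obtains v where "\<And>w. w \<in> words s (Suc n) \<Longrightarrow> x_word w \<Longrightarrow> u w - x_boundary w v \<in> M"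
proof -
  consider "n = 0" | "n = 1" | m where "n = m + 2"
    by (metis One_nat_def add_2_eq_Suc' not0_implies_Suc)
  then have "\<exists>v. \<forall>w\<in>words s (Suc n). x_word w \<longrightarrow> u w - x_boundary w v \<in> M"
  proof cases
    case 1
    then have "x * u StepX \<in> M" using u[of Stop] by simp
    then obtain v where v: "u StepX - (\<Sum>l\<in>L. g l * v l) \<in> M" using x_annihilates by blast
    show ?thesis
    proof (intro exI[of _ "\<lambda>w. case w of Column l w' \<Rightarrow> v l | _ \<Rightarrow> 0"] ballI impI)
      fix w assume "w \<in> words s (Suc n)" "x_word w"
      then have "w = StepX" using 1 by (cases w) (auto simp: words_def)
      then show "u w - x_boundary w (\<lambda>w. case w of Column l w' \<Rightarrow> v l | _ \<Rightarrow> 0) \<in> M" using v by simp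
    qed
  next
    case 2
    then have "(\<Sum>l\<in>L. g l * u (Column l Stop)) \<in> M" using u[of StepX] by (simp add: words_def)
    from g_independent[OF this] obtain c d where
      cd: "\<And>l. l \<in> L \<Longrightarrow> u (Column l Stop) = x * c l + p (st l) * d l" by metis
    define v where "v = (\<lambda>w. case w of Column l w' \<Rightarrow> (if w' = StepX then c l else d l) | _ \<Rightarrow> 0)"
    show ?thesis
    proof (intro exI[of _ v] ballI impI)
      fix w assume "w \<in> words s (Suc n)" "x_word w"
      then obtain l w' where l: "w = Column l w'" "l \<in> L" and "w' \<in> words (st l) 0"
        using 2 by (cases w) (auto simp: words_def)
      then show "u w - x_boundary w v \<in> M" using cd[of l] by (simp add: v_def M_zero)
    qed
  next
    case 3
    have "\<exists>v. \<forall>w\<in>words (st l) (Suc m). u (Column l w) - boundary w (st l) v \<in> M" if l: "l \<in> L" for l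
    proof -
      have "\<forall>w\<in>words (st l) m. boundary w (st l) (\<lambda>w. u (Column l w)) \<in> M"
      proof
        fix w assume "w \<in> words (st l) m"
        then have "Column l w \<in> words s n" using 3 l by (auto simp: words_def)
        from u[OF this] show "boundary w (st l) (\<lambda>w. u (Column l w)) \<in> M" by simp
      qed
      then show ?thesis using IH[of "st l" m] 3 st_States[OF l] by (auto simp: exact_at_def)
    qed
    then obtain v where v: "\<And>l w. l \<in> L \<Longrightarrow> w \<in> words (st l) (Suc m) \<Longrightarrow>
        u (Column l w) - boundary w (st l) (v l) \<in> M" by metis
    define v' where "v' = (\<lambda>w. case w of Column l w' \<Rightarrow> v l w' | _ \<Rightarrow> 0)"
    show ?thesis
    proof (intro exI[of _ v'] ballI impI)
      fix w assume "w \<in> words s (Suc n)" "x_word w"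
      then obtain l w' where "w = Column l w'" "l \<in> L" "w' \<in> words (st l) (Suc m)"
        using 3 by (cases w) (auto simp: words_def)
      then show "u w - x_boundary w v' \<in> M" using v[of l w'] by (simp add: v'_def)
    qed
  qed
  then show thesis using that by blast
qed

text \<open>
  Exactness of the mapping cone. A cycle restricts to a cycle on the words beginning with \<open>StepY\<close>,
  where it bounds by induction, or by the annihilator condition in degree \<open>0\<close>. Subtracting the image of
  this bounding element under the connecting map leaves a cycle in the resolution of \<open>S/xS\<close>.
\<close>

theorem exact: "s \<in> States \<Longrightarrow> exact_at s n"
proof (induction n arbitrary: s rule: less_induct)
  case (less n)
  note IH = less.IH and s = \<open>s \<in> States\<close>
  show ?case unfolding exact_at_def
  proof (intro allI impI)
    fix u assume u: "\<forall>w\<in>words s n. boundary w s u \<in> M"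
    \<comment> \<open>The part of \<open>u\<close> on words beginning with \<open>StepY\<close> bounds; the sign is that of the shifted complex.\<close>
    obtain v' where v': "fin s \<Longrightarrow> w \<in> words (nxt s) n \<Longrightarrow> u (StepY w) + boundary w (nxt s) v' \<in> M" for w
    proof (cases "fin s")
      case True
      have ns: "nxt s \<in> States" by (rule nxt_States[OF s True])
      show thesis
      proof (cases n)
        case 0
        then have "x * u StepX + p s * u (StepY Stop) \<in> M" using bspec[OF u, of Stop] by simp
        from p_annihilates[OF s True this] obtain c d
          where "u (StepY Stop) = x * c + p (nxt s) * d" by blast
        then show thesis using 0 that[of "\<lambda>w. if w = StepX then - c else - d"] by (auto simp: M_zero)
      next
        case (Suc m)
        have "\<forall>w\<in>words (nxt s) m. boundary w (nxt s) (\<lambda>w. u (StepY w)) \<in> M"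
        proof
          fix w assume "w \<in> words (nxt s) m"
          then have "StepY w \<in> words s n" using Suc True by (auto simp: words_def)
          then show "boundary w (nxt s) (\<lambda>w. u (StepY w)) \<in> M" using u by fastforce
        qed
        then obtain v where v: "\<And>w. w \<in> words (nxt s) n \<Longrightarrow> u (StepY w) - boundary w (nxt s) v \<in> M"
          using IH[of m "nxt s"] ns Suc unfolding exact_at_def by blast
        show thesis
          using that[of "\<lambda>w. -1 * v w"] v unfolding boundary_scale by simp
      qed
    qed (use that in auto)
    \<comment> \<open>Remove from \<open>u\<close> the image of \<open>v'\<close> under the connecting map.\<close>
    define u' where "u' = (\<lambda>w. u w + (- p s) * v' w)"
    have "x_boundary w u' \<in> M" if w: "w \<in> words s n" "x_word w" for w
    proof -
      have 1: "x_boundary w u + p s * u (StepY w) \<in> M" using u w boundary_x_word by metis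
      have 2: "p s * (u (StepY w) + x_boundary w v') \<in> M"
      proof (cases "fin s")
        case True
        then have "w \<in> words (nxt s) n"
          using w by (cases w) (auto simp: words_def)
        then have "p s * (u (StepY w) + boundary w (nxt s) v') \<in> M"
          using v' True M_mult by blast
        moreover have "p s * (p (nxt s) * v' (StepY w)) \<in> M"
          using M_mult2[OF p_nxt[OF s True]] by (simp add: mult.assoc)
        ultimately have "p s * (u (StepY w) + boundary w (nxt s) v') - p s * (p (nxt s) * v' (StepY w)) \<in> M"
          by (rule M_diff)
        then show ?thesis using boundary_x_word[OF w(2)] by (simp add: algebra_simps)
      qed (use p_not_fin s M_zero in auto)
      show ?thesis
        using M_diff[OF 1 2] unfolding u'_def x_boundary_add x_boundary_scale by (simp add: algebra_simps)
    qed
    from x_part_exact[OF _ s this] IH obtain u'' where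
      u'': "\<And>w. w \<in> words s (Suc n) \<Longrightarrow> x_word w \<Longrightarrow> u' w - x_boundary w u'' \<in> M" by blast
    define v where "v = (\<lambda>w. case w of StepY w' \<Rightarrow> v' w' | _ \<Rightarrow> u'' w)"
    show "\<exists>v. \<forall>w\<in>words s (Suc n). u w - boundary w s v \<in> M"
    proof (intro exI[of _ v] ballI)
      fix w assume w: "w \<in> words s (Suc n)"
      show "u w - boundary w s v \<in> M"
      proof (cases "x_word w")
        case True
        have "x_boundary w v = x_boundary w u''"
          by (rule x_boundary_cong) (auto simp: v_def split: word.splits)
        then have "u w - boundary w s v = u' w - x_boundary w u''"
          unfolding boundary_x_word[OF True] by (simp add: v_def u'_def)
        then show ?thesis using u'' w True by simp
      next
        case False
        then obtain w' where "w = StepY w'" by (cases w) auto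
        then show ?thesis using v'[of w'] w by (auto simp: words_def v_def)
      qed
    qed
  qed
qed

lemma boundary_in_subideal:
  assumes J: "0 \<in> J" "\<And>u v. u \<in> J \<Longrightarrow> v \<in> J \<Longrightarrow> u + v \<in> J" "\<And>c u. u \<in> J \<Longrightarrow> c * u \<in> J"
    and "x \<in> J" "\<And>s. s \<in> States \<Longrightarrow> p s \<in> J" "\<And>l. l \<in> L \<Longrightarrow> g l \<in> J"
    and "s \<in> States" "valid w s"
  shows "boundary w s u \<in> J"
proof -
  have mult: "c * v \<in> J" if "c \<in> J" for c v
    using J(3)[OF that, of v] by (simp add: mult.commute)
  have sum: "sum f A \<in> J" if "\<And>l. l \<in> A \<Longrightarrow> f l \<in> J" for f and A :: "nat set"
    using that by (induction A rule: infinite_finite_induct) (auto intro: J)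
  show ?thesis using assms(7,8)
  proof (induction w arbitrary: s u)
    case (Column l w)
    then show ?case using assms(5)[of s] by (auto intro!: J(2) mult Column.IH st_States)
  next
    case (StepY w)
    then have "boundary w (nxt s) (\<lambda>w'. u (StepY w')) \<in> J" by (auto intro!: StepY.IH nxt_States)
    from J(3)[OF this, of "-1"] show ?case by simp
  qed (use assms in \<open>auto intro!: J(2) mult sum\<close>)
qed

lemma words_1: "words s (Suc 0) = insert StepX (if fin s then {StepY Stop} else {})"
proof -
  have "w \<in> words s (Suc 0) \<longleftrightarrow> w \<in> insert StepX (if fin s then {StepY Stop} else {})" for w
    by (cases w) (auto simp: words_def)
  then show ?thesis by blast
qed

lemma words_Suc_Suc: "words s (Suc (Suc n)) =
    (\<Union>l\<in>L. Column l ` words (st l) n) \<union> (if fin s then StepY ` words (nxt s) (Suc n) else {})"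
proof -
  have "w \<in> words s (Suc (Suc n)) \<longleftrightarrow>
      w \<in> (\<Union>l\<in>L. Column l ` words (st l) n) \<union> (if fin s then StepY ` words (nxt s) (Suc n) else {})" for w
    by (cases w) (auto simp: words_def)
  then show ?thesis by blast
qed

lemma finite_words: "finite (words s n)"
proof (induction n arbitrary: s rule: less_induct)
  case (less n)
  consider "n = 0" | "n = Suc 0" | m where "n = Suc (Suc m)" by (metis not0_implies_Suc)
  then show ?case
  proof cases
    case 3
    then have "finite (words t m)" "finite (words t (Suc m))" for t using less[of m] less[of "Suc m"] by auto
    then show ?thesis by (simp add: 3 words_Suc_Suc finite_L)
  qed (simp_all add: words_1)
qed

lemma card_words_Suc_Suc: "card (words s (Suc (Suc n))) =
    (\<Sum>l\<in>L. card (words (st l) n)) + (if fin s then card (words (nxt s) (Suc n)) else 0)"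
proof -
  have "card (\<Union>l\<in>L. Column l ` words (st l) n) = (\<Sum>l\<in>L. card (Column l ` words (st l) n))"
    by (rule card_UN_disjoint) (auto simp: finite_L finite_words)
  also have "\<dots> = (\<Sum>l\<in>L. card (words (st l) n))"
    by (intro sum.cong refl card_image) (auto simp: inj_on_def)
  finally have 1: "card (\<Union>l\<in>L. Column l ` words (st l) n) = (\<Sum>l\<in>L. card (words (st l) n))" .
  have "card (StepY ` words (nxt s) (Suc n)) = card (words (nxt s) (Suc n))"
    by (rule card_image) (auto simp: inj_on_def)
  moreover have "(\<Union>l\<in>L. Column l ` words (st l) n) \<inter> StepY ` words (nxt s) (Suc n) = {}" by auto
  ultimately show ?thesis
    unfolding words_Suc_Suc using 1 by (auto simp: card_Un_disjoint finite_L finite_words)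
qed

end

section \<open>Monomial ideals in two variables\<close>

definition coeff_xy :: "'k::field poly poly \<Rightarrow> nat \<Rightarrow> nat \<Rightarrow> 'k" where
  "coeff_xy f i j = coeff (coeff f j) i"

lemma coeff_xy_add [simp]: "coeff_xy (f + g) i j = coeff_xy f i j + coeff_xy g i j"
  and coeff_xy_0 [simp]: "coeff_xy 0 i j = 0"
  by (simp_all add: coeff_xy_def)

lemma coeff_xy_sum: "coeff_xy (sum f A) i j = (\<Sum>l\<in>A. coeff_xy (f l) i j)"
  by (simp add: coeff_xy_def coeff_sum)

lemma monomial_eq_monom: "(var_x :: 'k::field poly poly) ^ i * var_y ^ j = monom (monom 1 i) j"
proof -
  have "(var_x :: 'k poly poly) ^ i = monom (monom 1 i) 0" for i
    by (induction i) (simp_all add: var_x_def mult_monom monom_0 monom_Suc one_pCons)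
  moreover have "(var_y :: 'k poly poly) ^ j = monom 1 j" for j
    by (induction j) (simp_all add: var_y_def monom_Suc)
  ultimately show ?thesis by (simp add: mult_monom)
qed

lemma coeff_xy_monomial_mult:
  "coeff_xy (var_x ^ i * var_y ^ j * f) p q = (if i \<le> p \<and> j \<le> q then coeff_xy f (p - i) (q - j) else 0)"
  by (auto simp: monomial_eq_monom coeff_xy_def coeff_monom_mult)

lemma coeff_xy_var_x_mult: "coeff_xy (var_x * f) p q = (if 1 \<le> p then coeff_xy f (p - 1) q else 0)"
  using coeff_xy_monomial_mult[of 1 0 f p q] by simp

lemma coeff_xy_var_y_power_mult: "coeff_xy (var_y ^ j * f) p q = (if j \<le> q then coeff_xy f p (q - j) else 0)"
  using coeff_xy_monomial_mult[of 0 j f p q] by simp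

lemma monom_monom_eq: "monom (monom c i) j = [:[:c:]:] * (var_x ^ i * var_y ^ j)"
  by (simp add: monomial_eq_monom smult_monom)

text \<open>
  A property that is closed under sums holds for \<open>f\<close> once it holds for all multiples of the monomials
  that occur in \<open>f\<close>. Statements about monomial ideals are thereby reduced to monomials.
\<close>

lemma polynomial_xy_induct:
  fixes f :: "'k::field poly poly"
  assumes "P 0" "\<And>u v. P u \<Longrightarrow> P v \<Longrightarrow> P (u + v)"
    and "\<And>i j c. coeff_xy f i j \<noteq> 0 \<Longrightarrow> P (c * (var_x ^ i * var_y ^ j))"
  shows "P f"
proof -
  have sum: "P (sum h A)" if "finite A" "\<And>i. i \<in> A \<Longrightarrow> P (h i)" for h :: "nat \<Rightarrow> 'k poly poly" and A
    using that by (induction A rule: finite_induct) (auto intro: assms)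
  have "P (monom (coeff f j) j)" for j
  proof -
    have "monom (sum h A) j = (\<Sum>i\<in>A. monom (h i) j)" if "finite A" for h :: "nat \<Rightarrow> 'k poly" and A
      using that by (induction A rule: finite_induct) (auto simp: add_monom[symmetric])
    then have "monom (\<Sum>i\<le>degree (coeff f j). monom (coeff (coeff f j) i) i) j =
        (\<Sum>i\<le>degree (coeff f j). monom (monom (coeff_xy f i j) i) j)" by (simp add: coeff_xy_def)
    moreover have "P (\<Sum>i\<le>degree (coeff f j). monom (monom (coeff_xy f i j) i) j)"
    proof (intro sum)
      fix i show "P (monom (monom (coeff_xy f i j) i) j)"
        using assms(1) assms(3)[of i j "[:[:coeff_xy f i j:]:]"]
        by (cases "coeff_xy f i j = 0") (simp_all only: monom_monom_eq, simp_all)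
    qed simp
    ultimately show ?thesis by (simp add: poly_as_sum_of_monoms)
  qed
  then have "P (\<Sum>j\<le>degree f. monom (coeff f j) j)" by (intro sum) auto
  then show ?thesis by (simp add: poly_as_sum_of_monoms)
qed

text \<open>
  Membership in \<open>(x, y^c)\<close>, where \<open>y^\<infinity> = 0\<close>, is visible from the coefficients of the pure powers
  of \<open>y\<close>.
\<close>

lemma in_x_y_power_ideal:
  fixes f :: "'k::field poly poly"
  assumes "\<And>t. enat t < c \<Longrightarrow> coeff_xy f 0 t = 0"
  shows "\<exists>u v. f = var_x * u + (case c of enat c \<Rightarrow> var_y ^ c | \<infinity> \<Rightarrow> 0) * v"
proof (rule polynomial_xy_induct[where f = f])
  let ?p = "case c of enat c \<Rightarrow> var_y ^ c | \<infinity> \<Rightarrow> 0"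
  show "\<exists>u v. 0 = var_x * u + ?p * v" by (intro exI[of _ 0]) simp
  show "\<exists>u v. f + g = var_x * u + ?p * v" if "\<exists>u v. f = var_x * u + ?p * v" "\<exists>u v. g = var_x * u + ?p * v" for f g :: "'k poly poly"
  proof -
    from that obtain u v u' v' where "f = var_x * u + ?p * v" "g = var_x * u' + ?p * v'" by blast
    then have "f + g = var_x * (u + u') + ?p * (v + v')" by (simp add: algebra_simps)
    then show ?thesis by blast
  qed
  show "\<exists>u v. d * (var_x ^ i * var_y ^ j) = var_x * u + ?p * v" if nz: "coeff_xy f i j \<noteq> 0" for i j and d :: "'k poly poly"
  proof (cases i)
    case (Suc i')
    then have "d * (var_x ^ i * var_y ^ j) = var_x * (d * (var_x ^ i' * var_y ^ j)) + ?p * 0" by simp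
    then show ?thesis by blast
  next
    case 0
    then have "\<not> enat j < c" using assms nz by blast
    then obtain k where k: "c = enat k" "k \<le> j" by (cases c) auto
    then have "d * (var_x ^ i * var_y ^ j) = var_x * 0 + ?p * (d * var_y ^ (j - k))"
      using 0 by (simp add: power_add[symmetric])
    then show ?thesis by blast
  qed
qed

text \<open>
  The exponents of the generators, with the excluded case of two pure powers expressed by exponents.
\<close>

locale staircase =
  fixes a b :: "nat \<Rightarrow> nat" and r :: nat
  assumes a: "strict_antimono_on {1..r} a" and b: "strict_mono_on {1..r} b"
    and r: "r > 2 \<or> (r = 2 \<and> (b 1 > 0 \<or> a 2 > 0))"
begin

definition in_ideal :: "nat \<Rightarrow> nat \<Rightarrow> bool" where
  "in_ideal i j \<longleftrightarrow> (\<exists>l\<in>{1..r}. a l \<le> i \<and> b l \<le> j)"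

text \<open>
  The monomial ideal described by coefficients, since its uses below are tests of single
  coefficients; lemma \<open>M_eq_Idl\<close> identifies it with the ideal generated by the monomials.
\<close>

definition M :: "'k::field poly poly set" where
  "M = {f. \<forall>i j. coeff_xy f i j \<noteq> 0 \<longrightarrow> in_ideal i j}"

lemma in_ideal_mono: "in_ideal i j \<Longrightarrow> i \<le> i' \<Longrightarrow> j \<le> j' \<Longrightarrow> in_ideal i' j'"
  unfolding in_ideal_def by (meson order_trans)

lemma M_zero: "0 \<in> M" by (simp add: M_def)

lemma M_add: "u \<in> M \<Longrightarrow> v \<in> M \<Longrightarrow> u + v \<in> M"
  unfolding M_def by auto (metis add.left_neutral)

lemma M_monomial_mult:
  assumes "in_ideal i j"
  shows "var_x ^ i * var_y ^ j * f \<in> M"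
  unfolding M_def using in_ideal_mono[OF assms] by (auto simp: coeff_xy_monomial_mult split: if_splits)

lemma M_mult:
  fixes u c :: "'k::field poly poly"
  assumes u: "u \<in> M"
  shows "c * u \<in> M"
proof -
  show "c * u \<in> M"
  proof (rule polynomial_xy_induct[where f = u])
    show "c * (0::'k poly poly) \<in> M" by (simp add: M_zero)
    show "\<And>u v :: 'k poly poly. c * u \<in> M \<Longrightarrow> c * v \<in> M \<Longrightarrow> c * (u + v) \<in> M"
      by (simp add: distrib_left M_add)
    fix i j and d :: "'k poly poly" assume "coeff_xy u i j \<noteq> 0"
    then have "in_ideal i j" using u by (auto simp: M_def)
    from M_monomial_mult[OF this, of "c * d"]
    show "c * (d * (var_x ^ i * var_y ^ j)) \<in> M" by (simp add: ac_simps)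
  qed
qed

lemma a_less: "1 \<le> l \<Longrightarrow> l < l' \<Longrightarrow> l' \<le> r \<Longrightarrow> a l' < a l"
  using a unfolding monotone_on_def by simp

lemma b_less: "1 \<le> l \<Longrightarrow> l < l' \<Longrightarrow> l' \<le> r \<Longrightarrow> b l < b l'"
  using b unfolding monotone_on_def by simp

lemma a_le: "1 \<le> l \<Longrightarrow> l \<le> l' \<Longrightarrow> l' \<le> r \<Longrightarrow> a l' \<le> a l"
  using a_less[of l l'] by (cases "l = l'") auto

lemma b_le: "1 \<le> l \<Longrightarrow> l \<le> l' \<Longrightarrow> l' \<le> r \<Longrightarrow> b l \<le> b l'"
  using b_less[of l l'] by (cases "l = l'") auto

text \<open>
  The monomials annihilated by \<open>x\<close> modulo \<open>M\<close> form vertical columns, one to the left of each generator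
  with positive \<open>x\<close>-exponent. The column of the last generator is bounded by no further generator, so
  it has infinite height.
\<close>

definition cols :: "nat set" where "cols = {l \<in> {1..r}. 1 \<le> a l}"

definition col_gen :: "nat \<Rightarrow> 'k::field poly poly" where "col_gen l = var_x ^ (a l - 1) * var_y ^ b l"

definition col_height :: "nat \<Rightarrow> enat" where
  "col_height l = (if l < r then enat (b (Suc l) - b l) else \<infinity>)"

text \<open>
  The smallest exponent of a power of \<open>y\<close> in \<open>M\<close>, if there is one.
\<close>

definition y_height :: enat where
  "y_height = (if a r = 0 then enat (b r) else \<infinity>)"

definition y_power :: "enat \<Rightarrow> 'k::field poly poly" where
  "y_power c = (case c of enat c \<Rightarrow> var_y ^ c | \<infinity> \<Rightarrow> 0)"

definition finite_height :: "enat \<Rightarrow> bool" where "finite_height c \<longleftrightarrow> c \<noteq> \<infinity>"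

definition co_height :: "enat \<Rightarrow> enat" where "co_height c = y_height - c"

text \<open>
  The heights \<open>0\<close> and, if finite, \<open>y_height\<close> are left out: at them \<open>y_power\<close> of the height or of its
  complement would be \<open>1\<close>, and the resolution would not be minimal.
\<close>

definition heights :: "enat set" where
  "heights = {c. 1 \<le> c \<and> (c < y_height \<or> y_height = \<infinity>)}"

lemma r_ge_2: "2 \<le> r" using r by auto

lemma cols_eq: "cols = (if a r = 0 then {1..<r} else {1..r})"
proof (rule Set.set_eqI)
  fix l
  have "1 \<le> l \<Longrightarrow> l < r \<Longrightarrow> 0 < a l" using a_less[of l r] by simp
  then show "l \<in> cols \<longleftrightarrow> l \<in> (if a r = 0 then {1..<r} else {1..r})"
    by (cases "l = r") (auto simp: cols_def Suc_le_eq)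
qed

lemma one_in_heights: "1 \<in> heights"
proof -
  have "1 < b r" if "a r = 0"
  proof (cases "r > 2")
    case True
    then show ?thesis using b_less[of 1 2] b_less[of 2 r] by simp
  next
    case False
    then have "r = 2" "0 < b 1" using r that by auto
    then show ?thesis using b_less[of 1 2] by simp
  qed
  then show ?thesis by (simp add: heights_def y_height_def one_enat_def)
qed

text \<open>
  A column of height \<open>y_height = b r\<close> would start at \<open>y\<close>-exponent \<open>0\<close> and end at the last generator,
  so there would be just two generators, both of them pure powers.
\<close>

lemma col_height_in_heights:
  assumes "l \<in> cols"
  shows "col_height l \<in> heights"
proof (cases "l < r")
  case True
  have l: "1 \<le> l" using assms by (simp add: cols_def)
  have "b l < b (Suc l)" using b_less[of l "Suc l"] True l by simp
  moreover have "b (Suc l) - b l < b r" if "a r = 0"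
  proof (cases "Suc l = r")
    case eq: True
    have "0 < b l"
    proof (cases "l = 1")
      case True then show ?thesis using r eq that by (auto simp: numeral_2_eq_2)
    next
      case False then show ?thesis using b_less[of 1 l] l True by simp
    qed
    then show ?thesis using eq \<open>b l < b (Suc l)\<close> by simp
  next
    case False
    then show ?thesis using b_less[of "Suc l" r] True l by simp
  qed
  ultimately show ?thesis using True by (auto simp: heights_def col_height_def y_height_def one_enat_def)
next
  case False
  then have "l = r" "a r \<noteq> 0" using assms by (auto simp: cols_def)
  then show ?thesis by (simp add: heights_def col_height_def y_height_def)
qed

lemma co_height_in_heights: "c \<in> heights \<Longrightarrow> finite_height c \<Longrightarrow> co_height c \<in> heights"
  by (cases c; cases y_height) (auto simp: heights_def one_enat_def finite_height_def co_height_def)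

lemma y_power_infinity [simp]: "y_power \<infinity> = 0" and y_power_enat [simp]: "y_power (enat c) = var_y ^ c"
  by (simp_all add: y_power_def)

lemma y_power_y_height_in_M: "y_power y_height \<in> M"
proof (cases "a r = 0")
  case True
  then have "in_ideal 0 (b r)" using r_ge_2 by (auto simp: in_ideal_def)
  from M_monomial_mult[OF this, of 1] show ?thesis using True by (simp add: y_height_def)
qed (simp add: y_height_def M_zero)

lemma y_power_mult_in_M:
  assumes "c \<in> heights" "finite_height c"
  shows "(y_power c :: 'k::field poly poly) * y_power (co_height c) \<in> M"
proof (cases y_height)
  case (enat k)
  obtain i where i: "c = enat i" "i \<le> k" using assms enat by (cases c) (auto simp: heights_def)
  then have "(y_power c :: 'k poly poly) * y_power (co_height c) = y_power y_height"
    by (simp add: co_height_def enat power_add[symmetric])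
  then show ?thesis using y_power_y_height_in_M by simp
qed (use assms in \<open>auto simp: M_zero finite_height_def co_height_def\<close>)

lemma x_col_gen_in_M: "l \<in> cols \<Longrightarrow> var_x * col_gen l \<in> M"
proof -
  assume l: "l \<in> cols"
  then have "in_ideal (a l) (b l)" by (auto simp: in_ideal_def cols_def)
  from M_monomial_mult[OF this, of 1] show ?thesis
    using l by (simp add: col_gen_def cols_def mult.assoc[symmetric] power_Suc[symmetric] del: power_Suc)
qed

lemma col_gen_y_power_in_M:
  assumes "l \<in> cols"
  shows "col_gen l * y_power (col_height l) \<in> M"
proof (cases "l < r")
  case True
  have l: "1 \<le> l" using assms by (simp add: cols_def)
  have "in_ideal (a l - 1) (b (Suc l))"
    unfolding in_ideal_def using a_less[of l "Suc l"] True l by (intro bexI[of _ "Suc l"]) auto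
  from M_monomial_mult[OF this, of 1] show ?thesis
    using b_less[of l "Suc l"] True l
    by (simp add: col_gen_def col_height_def mult.assoc power_add[symmetric])
qed (simp add: col_height_def M_zero)

text \<open>
  If \<open>x\<close> moves a monomial into the staircase ideal, the monomial either lies in it already or is in the
  column of some generator.
\<close>

lemma annihilator_of_x:
  fixes u :: "'k::field poly poly"
  assumes "var_x * u \<in> M"
  shows "\<exists>v. u - (\<Sum>l\<in>cols. col_gen l * v l) \<in> M"
proof (rule polynomial_xy_induct[where f = u])
  show "\<exists>v. 0 - (\<Sum>l\<in>cols. col_gen l * v l) \<in> M" by (intro exI[of _ "\<lambda>_. 0"]) (simp add: M_zero)
next
  fix u w :: "'k poly poly" assume "\<exists>v. u - (\<Sum>l\<in>cols. col_gen l * v l) \<in> M" "\<exists>v. w - (\<Sum>l\<in>cols. col_gen l * v l) \<in> M"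
  then obtain v v' :: "nat \<Rightarrow> 'k poly poly" where "u - (\<Sum>l\<in>cols. col_gen l * v l) \<in> M" "w - (\<Sum>l\<in>cols. col_gen l * v' l) \<in> M" by blast
  from M_add[OF this] have "u + w - (\<Sum>l\<in>cols. col_gen l * (v l + v' l)) \<in> M"
    by (simp add: algebra_simps sum.distrib)
  then show "\<exists>v. u + w - (\<Sum>l\<in>cols. col_gen l * v l) \<in> M" by (intro exI)
next
  fix i j and d :: "'k poly poly" assume "coeff_xy u i j \<noteq> 0"
  then have "coeff_xy (var_x * u) (Suc i) j \<noteq> 0" by (simp add: coeff_xy_var_x_mult)
  then have "in_ideal (Suc i) j" using assms by (auto simp: M_def)
  then obtain l where l: "l \<in> {1..r}" "a l \<le> Suc i" "b l \<le> j" by (auto simp: in_ideal_def)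
  show "\<exists>v. d * (var_x ^ i * var_y ^ j) - (\<Sum>l\<in>cols. col_gen l * v l) \<in> M"
  proof (cases "a l = Suc i")
    case True
    have "d * (var_x ^ i * var_y ^ j) = (\<Sum>l'\<in>cols. col_gen l' * (if l' = l then d * var_y ^ (j - b l) else 0))"
    proof -
      have "(\<Sum>l'\<in>cols. col_gen l' * (if l' = l then d * var_y ^ (j - b l) else 0)) =
          (\<Sum>l'\<in>cols. if l' = l then col_gen l' * (d * var_y ^ (j - b l)) else 0)"
        by (intro sum.cong) auto
      also have "\<dots> = col_gen l * (d * var_y ^ (j - b l))"
        using l True by (subst sum.delta) (auto simp: cols_def)
      also have "\<dots> = d * (var_x ^ i * (var_y ^ b l * var_y ^ (j - b l)))"
        using True by (simp add: col_gen_def ac_simps)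
      finally show ?thesis using l by (simp add: power_add[symmetric])
    qed
    then show ?thesis by (intro exI[of _ "\<lambda>l'. if l' = l then d * var_y ^ (j - b l) else 0"]) (simp add: M_zero)
  next
    case False
    then have "in_ideal i j" unfolding in_ideal_def using l by (intro bexI[of _ l]) auto
    from M_monomial_mult[OF this, of d] show ?thesis
      by (intro exI[of _ "\<lambda>_. 0"]) (simp add: ac_simps)
  qed
qed

text \<open>
  The columns are disjoint, and the monomial at height \<open>t\<close> in the column \<open>l\<close> lies outside \<open>M\<close>. Its
  coefficient in the sum receives a contribution from the summand \<open>l\<close> only, namely the
  coefficient of \<open>y^t\<close> in \<open>v l\<close>: generators to the left start above this column, those to the right have
  too large an \<open>x\<close>-exponent.
\<close>

lemma col_gens_independent:
  assumes "(\<Sum>l\<in>cols. col_gen l * v l) \<in> M" "l \<in> cols"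
  shows "\<exists>c d. v l = var_x * c + y_power (col_height l) * d"
  unfolding y_power_def
proof (rule in_x_y_power_ideal)
  fix t assume t: "enat t < col_height l"
  have l: "1 \<le> l" "l \<le> r" "1 \<le> a l" using assms(2) by (auto simp: cols_def)
  \<comment> \<open>All generators beyond the column start above the height \<open>t\<close> in it.\<close>
  have later: "b l + t < b l'" if "l < l'" "l' \<le> r" for l'
    using t that b_le[of "Suc l" l'] by (auto simp: col_height_def split: if_splits)
  have "\<not> in_ideal (a l - 1) (b l + t)"
  proof
    assume "in_ideal (a l - 1) (b l + t)"
    then obtain l' where l': "1 \<le> l'" "l' \<le> r" "a l' \<le> a l - 1" "b l' \<le> b l + t" by (auto simp: in_ideal_def)
    then have "l < l'" using a_le[of l' l] l by (cases "l < l'") auto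
    then show False using later[of l'] l' by simp
  qed
  then have "coeff_xy (\<Sum>l\<in>cols. col_gen l * v l) (a l - 1) (b l + t) = 0"
    using assms(1) by (auto simp: M_def)
  moreover have "coeff_xy (col_gen l' * v l') (a l - 1) (b l + t) = (if l' = l then coeff_xy (v l) 0 t else 0)"
    if "l' \<in> cols" for l'
  proof -
    have l': "1 \<le> l'" "l' \<le> r" "1 \<le> a l'" using that by (auto simp: cols_def)
    consider "l' = l" | "l < l'" | "l' < l" by linarith
    then show ?thesis
    proof cases
      case 2 then show ?thesis using later[of l'] l' by (simp add: col_gen_def coeff_xy_monomial_mult)
    next
      case 3 then show ?thesis using a_less[of l' l] l l' by (auto simp: col_gen_def coeff_xy_monomial_mult)
    qed (simp add: col_gen_def coeff_xy_monomial_mult)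
  qed
  ultimately have "(\<Sum>l'\<in>cols. if l' = l then coeff_xy (v l) 0 t else 0) = 0"
    by (simp add: coeff_xy_sum)
  then show "coeff_xy (v l) 0 t = 0" using assms(2) by (simp add: cols_def)
qed

lemma annihilator_of_y_power:
  assumes "c \<in> heights" "finite_height c" "var_x * u + y_power c * v \<in> M"
  shows "\<exists>s t. v = var_x * s + y_power (co_height c) * t"
  unfolding y_power_def
proof (rule in_x_y_power_ideal)
  fix t assume t: "enat t < co_height c"
  obtain k where k: "c = enat k" using assms(2) by (cases c) (auto simp: finite_height_def)
  have "\<not> in_ideal 0 (k + t)"
  proof
    assume "in_ideal 0 (k + t)"
    then obtain l where l: "1 \<le> l" "l \<le> r" "a l = 0" "b l \<le> k + t" by (auto simp: in_ideal_def)
    then have "l = r" using a_less[of l r] by (cases "l = r") auto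
    then show False using l t k by (simp add: co_height_def y_height_def)
  qed
  then have "coeff_xy (var_x * u + y_power c * v) 0 (k + t) = 0"
    using assms(3) by (auto simp: M_def)
  then show "coeff_xy v 0 t = 0"
    by (simp add: k coeff_xy_var_x_mult coeff_xy_var_y_power_mult)
qed

end

section \<open>The homogeneous maximal ideal of the quotient\<close>

definition xy_polys :: "'k::field poly poly set" where
  "xy_polys = {f. coeff_xy f 0 0 = 0}"

lemma xy_polys_ideal: "ideal xy_polys poly_ring_xy"
proof (intro ideal_of_type_algebraI)
  fix c u :: "'a poly poly" assume "u \<in> xy_polys"
  then show "c * u \<in> xy_polys" by (simp add: xy_polys_def coeff_xy_def coeff_mult_0)
qed (auto simp: xy_polys_def)

lemma xy_polysE:
  assumes "f \<in> xy_polys"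
  obtains u v where "f = var_x * u + var_y * v"
proof -
  have "coeff_xy f 0 t = 0" if "enat t < enat 1" for t using assms that by (simp add: xy_polys_def)
  from in_x_y_power_ideal[of "enat 1" f, OF this] show thesis using that by auto
qed

text \<open>
  Maximality comes from the constant terms: an element outside \<open>(x,y)S\<close> has a representative with
  nonzero constant term, so a multiple of it differs from \<open>1\<close> by an element of \<open>(x,y)S\<close>.
\<close>

lemma quotient_xy_maximalideal:
  fixes M :: "'k::field poly poly set"
  assumes M: "ideal M poly_ring_xy" "M \<subseteq> xy_polys"
  shows "ideal_xy M = (\<lambda>f. M +>\<^bsub>poly_ring_xy\<^esub> f) ` xy_polys" (is "_ = ?\<pi> ` _")
    and "maximalideal (ideal_xy M) (poly_ring_xy Quot M)"
proof -
  interpret R: cring "poly_ring_xy :: 'k poly poly ring" ..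
  interpret M: ideal M poly_ring_xy by fact
  let ?S = "poly_ring_xy Quot M"
  interpret S: cring ?S by (rule M.quotient_is_cring[OF R.cring_axioms])
  note hom = M.rcos_ring_hom
  have \<pi>c: "?\<pi> f \<in> carrier ?S" for f using ring_hom_closed[OF hom] by simp
  have \<pi>_add: "?\<pi> (f + g) = ?\<pi> f \<oplus>\<^bsub>?S\<^esub> ?\<pi> g" for f g using ring_hom_add[OF hom, of f g] by simp
  have \<pi>_mult: "?\<pi> (f * g) = ?\<pi> f \<otimes>\<^bsub>?S\<^esub> ?\<pi> g" for f g using ring_hom_mult[OF hom, of f g] by simp
  have \<pi>_one: "?\<pi> 1 = \<one>\<^bsub>?S\<^esub>" using ring_hom_one[OF hom] by simp
  have \<pi>_eq: "?\<pi> f = ?\<pi> g \<longleftrightarrow> f - g \<in> M" for f g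
    using R.quotient_eq_iff_same_a_r_cos[OF M(1), of f g] by simp
  have carr: "carrier ?S = range ?\<pi>" by (simp add: carrier_FactRing)
  note xy = ideal_of_type_algebraD[OF xy_polys_ideal]
  have G: "{?\<pi> var_x, ?\<pi> var_y} \<subseteq> carrier ?S" using \<pi>c by simp
  have id: "ideal (ideal_xy M) ?S" unfolding ideal_xy_def by (rule S.genideal_ideal[OF G])
  interpret I: ideal "ideal_xy M" ?S by (rule id)
  have GI: "?\<pi> var_x \<in> ideal_xy M" "?\<pi> var_y \<in> ideal_xy M"
    using S.genideal_self[OF G] unfolding ideal_xy_def by auto
  have "ideal (?\<pi> ` xy_polys) ?S"
  proof (rule idealI)
    show "ring ?S" by (rule S.ring_axioms)
    show "subgroup (?\<pi> ` xy_polys) (add_monoid ?S)"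
    proof (rule S.add.subgroupI)
      show "?\<pi> ` xy_polys \<subseteq> carrier ?S" using \<pi>c by auto
      show "?\<pi> ` xy_polys \<noteq> {}" using xy(1) by auto
      show "u \<oplus>\<^bsub>?S\<^esub> v \<in> ?\<pi> ` xy_polys" if "u \<in> ?\<pi> ` xy_polys" "v \<in> ?\<pi> ` xy_polys" for u v
      proof -
        from that obtain f g where fg: "f \<in> xy_polys" "u = ?\<pi> f" "g \<in> xy_polys" "v = ?\<pi> g" by auto
        show ?thesis unfolding fg \<pi>_add[symmetric] by (intro imageI xy(2) fg)
      qed
      show "\<ominus>\<^bsub>?S\<^esub> u \<in> ?\<pi> ` xy_polys" if "u \<in> ?\<pi> ` xy_polys" for u
      proof -
        from that obtain f where f: "f \<in> xy_polys" "u = ?\<pi> f" by auto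
        have "?\<pi> (-1) \<otimes>\<^bsub>?S\<^esub> u \<in> ?\<pi> ` xy_polys" 
          unfolding f \<pi>_mult[symmetric] by (intro imageI xy(3) f)
        moreover have "?\<pi> (- 1) = \<ominus>\<^bsub>?S\<^esub> \<one>\<^bsub>?S\<^esub>"
          using S.minus_equality[of "?\<pi> (-1)" "?\<pi> 1"] \<pi>c \<pi>_add[of "-1" 1] \<pi>_add[of 0 0] \<pi>_one
          by (metis S.add.l_cancel_one' add.left_inverse add_0)
        ultimately show ?thesis using \<pi>c f by (simp add: S.l_minus)
      qed
    qed
    fix u s assume "u \<in> ?\<pi> ` xy_polys" "s \<in> carrier ?S"
    then obtain f g where fg: "f \<in> xy_polys" "u = ?\<pi> f" "s = ?\<pi> g" using carr by auto
    show "s \<otimes>\<^bsub>?S\<^esub> u \<in> ?\<pi> ` xy_polys"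
      unfolding fg \<pi>_mult[symmetric] by (intro imageI xy(3) fg)
    show "u \<otimes>\<^bsub>?S\<^esub> s \<in> ?\<pi> ` xy_polys"
      unfolding fg \<pi>_mult[symmetric] mult.commute[of f g] by (intro imageI xy(3) fg)
  qed
  moreover have "{?\<pi> var_x, ?\<pi> var_y} \<subseteq> ?\<pi> ` xy_polys"
    by (auto simp: xy_polys_def coeff_xy_def var_x_def var_y_def)
  ultimately have "ideal_xy M \<subseteq> ?\<pi> ` xy_polys"
    unfolding ideal_xy_def by (rule S.genideal_minimal)
  moreover have "?\<pi> f \<in> ideal_xy M" if f: "f \<in> xy_polys" for f
  proof -
    obtain u v where "f = var_x * u + var_y * v" using xy_polysE[OF f] .
    then show ?thesis
      using GI \<pi>c by (simp add: \<pi>_add \<pi>_mult I.I_r_closed I.a_closed)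
  qed
  ultimately show eq: "ideal_xy M = ?\<pi> ` xy_polys" by blast
  have one: "\<one>\<^bsub>?S\<^esub> \<notin> ideal_xy M"
  proof
    assume "\<one>\<^bsub>?S\<^esub> \<in> ideal_xy M"
    then obtain f where "f \<in> xy_polys" "?\<pi> 1 = ?\<pi> f" using eq \<pi>_one by auto
    then have "1 - f \<in> xy_polys" "f \<in> xy_polys" using \<pi>_eq M(2) by auto
    from xy(2)[OF this] show False by (simp add: xy_polys_def coeff_xy_def)
  qed
  show "maximalideal (ideal_xy M) ?S"
  proof (rule maximalidealI[OF id])
    show "carrier ?S \<noteq> ideal_xy M" using one by auto
    fix J assume J: "ideal J ?S" "ideal_xy M \<subseteq> J" "J \<subseteq> carrier ?S"
    interpret J: ideal J ?S by fact
    show "J = ideal_xy M \<or> J = carrier ?S"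
    proof (rule disjCI)
      assume "J \<noteq> carrier ?S"
      then have oneJ: "\<one>\<^bsub>?S\<^esub> \<notin> J" using J.one_imp_carrier by blast
      have "?\<pi> f \<in> ideal_xy M" if f: "?\<pi> f \<in> J" for f
      proof (rule ccontr)
        assume "?\<pi> f \<notin> ideal_xy M"
        then have nz: "coeff_xy f 0 0 \<noteq> 0" using eq by (auto simp: xy_polys_def)
        define t :: "'k poly poly" where "t = [:[:inverse (coeff_xy f 0 0):]:]"
        have "1 - t * f \<in> xy_polys"
          using nz by (simp add: xy_polys_def t_def coeff_xy_def)
        then have "?\<pi> (1 - t * f) \<in> J" using eq J(2) by auto
        moreover have "?\<pi> (t * f) \<in> J" using f \<pi>c by (simp add: \<pi>_mult J.I_l_closed)
        ultimately have "?\<pi> (1 - t * f) \<oplus>\<^bsub>?S\<^esub> ?\<pi> (t * f) \<in> J" by (rule J.a_closed)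
        then show False using oneJ by (simp add: \<pi>_add[symmetric] \<pi>_one)
      qed
      then have "J \<subseteq> ideal_xy M" using J(3) carr by auto
      then show "J = ideal_xy M" using J(2) by blast
    qed
  qed
qed

section \<open>Betti numbers of the residue field\<close>

fun betti_sequence :: "nat \<Rightarrow> nat \<Rightarrow> nat" where
  "betti_sequence r 0 = 1"
| "betti_sequence r (Suc 0) = 2"
| "betti_sequence r (Suc (Suc n)) = betti_sequence r (Suc n) + (r - 1) * betti_sequence r n"

text \<open>
  The state of infinite height only occurs if no power of \<open>y\<close> lies in \<open>M\<close>; then \<open>S/xS = k[y]\<close>, and
  multiplication by \<open>y^c\<close> is injective there, in accordance with \<open>\<infinity> - c = \<infinity>\<close> and \<open>y^\<infinity> = 0\<close>.
\<close>

sublocale staircase \<subseteq> W: word_complex "M :: 'k::field poly poly set" var_x cols col_gen col_height heights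
  finite_height y_power co_height
proof
  show "finite cols" by (simp add: cols_def)
  show "y_power c = 0" if "\<not> finite_height c" for c using that by (simp add: finite_height_def)
qed (fact M_zero M_add M_mult col_height_in_heights co_height_in_heights y_power_mult_in_M
  x_col_gen_in_M col_gen_y_power_in_M annihilator_of_x col_gens_independent annihilator_of_y_power)+

context staircase
begin

lemma infinite_height: "\<not> finite_height \<infinity>"
  by (simp add: finite_height_def)

lemma col_height_cases:
  assumes "l \<in> {1..<r}"
  shows "col_height l \<in> heights" "finite_height (col_height l)"
  using assms col_height_in_heights[of l] cols_eq by (auto simp: col_height_def finite_height_def)

lemma sum_cols: "(\<Sum>l\<in>cols. f (col_height l)) =
    (\<Sum>l\<in>{1..<r}. f (col_height l)) + (if y_height = \<infinity> then f \<infinity> else (0::nat))"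
proof (cases "y_height = \<infinity>")
  case True
  then have "cols = insert r {1..<r}" using r_ge_2 by (auto simp: cols_eq y_height_def split: if_splits)
  then show ?thesis using True by (simp add: col_height_def)
qed (auto simp: cols_eq y_height_def)

text \<open>
  For finite \<open>y_height\<close> all states are finite and have the same number \<open>N n\<close> of words of degree \<open>n\<close>. For
  infinite \<open>y_height\<close>, let \<open>Q n\<close> be the number of words for the infinite state. A finite state then has
  \<open>(r - 1) N n + Q n + Q (n + 1)\<close> words of degree \<open>n + 2\<close>. The second claim,
  \<open>Q n + Q (n + 1) = N (n + 1)\<close>, turns this into the same recursion.
\<close>

lemma card_words:
  "(\<forall>c\<in>heights. finite_height c \<longrightarrow> card (W.words c n) = betti_sequence r n) \<and>
   (y_height = \<infinity> \<longrightarrow> card (W.words \<infinity> (Suc n)) + card (W.words \<infinity> n) = betti_sequence r (Suc n))"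
proof (induction n rule: less_induct)
  case (less n)
  have IH: "card (W.words c m) = betti_sequence r m" if "m < n" "c \<in> heights" "finite_height c" for c m
    using less that by blast
  have IH_inf: "card (W.words \<infinity> (Suc m)) + card (W.words \<infinity> m) = betti_sequence r (Suc m)"
    if "m < n" "y_height = \<infinity>" for m
    using less that by blast
  have cols_sum: "(\<Sum>l\<in>cols. card (W.words (col_height l) m)) =
      (r - 1) * betti_sequence r m + (if y_height = \<infinity> then card (W.words \<infinity> m) else 0)"
    if "\<And>c. c \<in> heights \<Longrightarrow> finite_height c \<Longrightarrow> card (W.words c m) = betti_sequence r m" for m
    unfolding sum_cols[of "\<lambda>c. card (W.words c m)"] using that col_height_cases by simp
  have fin: "card (W.words c n) = betti_sequence r n" if c: "c \<in> heights" "finite_height c" for c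
  proof -
    consider "n = 0" | "n = Suc 0" | m where "n = Suc (Suc m)" by (metis not0_implies_Suc)
    then show ?thesis
    proof cases
      case 3
      have sum: "(\<Sum>l\<in>cols. card (W.words (col_height l) m)) =
          (r - 1) * betti_sequence r m + (if y_height = \<infinity> then card (W.words \<infinity> m) else 0)"
        using IH 3 by (intro cols_sum) auto
      show ?thesis
      proof (cases "y_height = \<infinity>")
        case True
        then have "co_height c = \<infinity>" using c by (cases c) (auto simp: co_height_def finite_height_def)
        then show ?thesis
          unfolding 3 W.card_words_Suc_Suc sum using c True IH_inf[of m] 3 by simp
      next
        case False
        have "co_height c \<in> heights" "finite_height (co_height c)"
          using co_height_in_heights[OF c] False
          by (cases "co_height c"; auto simp: heights_def finite_height_def)+
        then have "card (W.words (co_height c) (Suc m)) = betti_sequence r (Suc m)"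
          using 3 by (intro IH) auto
        then show ?thesis
          unfolding 3 W.card_words_Suc_Suc sum using c False by (simp del: not_infinity_eq)
      qed
    qed (use c in \<open>simp_all add: W.words_1\<close>)
  qed
  have "card (W.words \<infinity> (Suc n)) + card (W.words \<infinity> n) = betti_sequence r (Suc n)" if inf: "y_height = \<infinity>"
  proof (cases n)
    case 0
    then show ?thesis by (simp add: W.words_1 infinite_height)
  next
    case (Suc m)
    have sum: "(\<Sum>l\<in>cols. card (W.words (col_height l) m)) =
        (r - 1) * betti_sequence r m + (if y_height = \<infinity> then card (W.words \<infinity> m) else 0)"
      using IH Suc by (intro cols_sum) auto
    show ?thesis
      unfolding Suc W.card_words_Suc_Suc sum using inf IH_inf[of m] Suc by (simp add: infinite_height)
  qed
  then show ?case using fin by blast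
qed

lemma M_eq_Idl: "(M :: 'k::field poly poly set) = Idl\<^bsub>poly_ring_xy\<^esub> ((\<lambda>l. var_x ^ a l * var_y ^ b l) ` {1..r})"
  (is "_ = Idl\<^bsub>_\<^esub> ?G")
proof
  interpret cring "poly_ring_xy :: 'k poly poly ring" ..
  have G: "?G \<subseteq> carrier poly_ring_xy" by simp
  interpret I: ideal "Idl\<^bsub>poly_ring_xy\<^esub> ?G" "poly_ring_xy :: 'k poly poly ring" by (rule genideal_ideal[OF G])
  note I = ideal_of_type_algebraD[OF I.is_ideal]
  show "M \<subseteq> Idl\<^bsub>poly_ring_xy\<^esub> ?G"
  proof
    fix f :: "'k poly poly" assume f: "f \<in> M"
    show "f \<in> Idl\<^bsub>poly_ring_xy\<^esub> ?G"
    proof (rule polynomial_xy_induct[where f = f])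
      fix i j and d :: "'k poly poly" assume "coeff_xy f i j \<noteq> 0"
      then have "in_ideal i j" using f by (auto simp: M_def)
      then obtain l where l: "l \<in> {1..r}" "a l \<le> i" "b l \<le> j" by (auto simp: in_ideal_def)
      then have "d * (var_x ^ i * var_y ^ j) =
          (d * var_x ^ (i - a l) * var_y ^ (j - b l)) * (var_x ^ a l * var_y ^ b l)"
        using power_add[of "var_x :: 'k poly poly" "i - a l" "a l"] power_add[of "var_y :: 'k poly poly" "j - b l" "b l"]
        by (simp add: ac_simps)
      moreover have "var_x ^ a l * var_y ^ b l \<in> Idl\<^bsub>poly_ring_xy\<^esub> ?G"
        by (rule subsetD[OF genideal_self[OF G]], rule imageI, rule l(1))
      ultimately show "d * (var_x ^ i * var_y ^ j) \<in> Idl\<^bsub>poly_ring_xy\<^esub> ?G"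
        by (simp only: I(3))
    qed (use I in auto)
  qed
  have "ideal (M :: 'k poly poly set) poly_ring_xy"
    by (intro ideal_of_type_algebraI M_zero M_add M_mult)
  moreover have "?G \<subseteq> M"
  proof
    fix f assume "f \<in> ?G"
    then obtain l where l: "l \<in> {1..r}" "f = var_x ^ a l * var_y ^ b l" by blast
    then have "in_ideal (a l) (b l)" by (auto simp: in_ideal_def)
    from M_monomial_mult[OF this, of 1] show "f \<in> M" using l by simp
  qed
  ultimately show "Idl\<^bsub>poly_ring_xy\<^esub> ?G \<subseteq> M" by (rule genideal_minimal)
qed

lemma M_subset_xy_polys: "M \<subseteq> xy_polys"
proof
  fix f :: "'k::field poly poly" assume "f \<in> M"
  moreover have "\<not> in_ideal 0 0"
  proof
    assume "in_ideal 0 0"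
    then obtain l where l: "1 \<le> l" "l \<le> r" "a l = 0" "b l = 0" by (auto simp: in_ideal_def)
    then show False using a_less[of l r] b_less[of 1 l] r_ge_2 by (cases "l = 1") auto
  qed
  ultimately show "f \<in> xy_polys" by (auto simp: M_def xy_polys_def)
qed

lemma col_gen_in_xy_polys:
  assumes "l \<in> cols"
  shows "col_gen l \<in> xy_polys"
proof -
  have l: "1 \<le> l" "l \<le> r" "1 \<le> a l" using assms by (auto simp: cols_def)
  have "a l \<noteq> 1 \<or> b l \<noteq> 0"
  proof (rule ccontr)
    assume "\<not> (a l \<noteq> 1 \<or> b l \<noteq> 0)"
    then have al: "a l = 1" "b l = 0" by auto
    then have "l = 1" using b_less[of 1 l] l by (cases "l = 1") auto
    have "\<not> 2 < r"
    proof
      assume "2 < r"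
      then show False using a_less[of 1 2] a_less[of 2 3] al \<open>l = 1\<close> by simp
    qed
    then have "r = 2" using r_ge_2 by linarith
    moreover have "a 2 = 0" using a_less[of 1 2] \<open>r = 2\<close> al \<open>l = 1\<close> by simp
    ultimately show False using r al \<open>l = 1\<close> by simp
  qed
  then show ?thesis
    using l coeff_xy_monomial_mult[of "a l - 1" "b l" 1 0 0] by (auto simp: xy_polys_def col_gen_def)
qed

lemma y_power_in_xy_polys:
  assumes "c \<in> heights"
  shows "y_power c \<in> xy_polys"
proof (cases c)
  case (enat k)
  then show ?thesis
    using assms coeff_xy_var_y_power_mult[of k 1 0 0] by (auto simp: xy_polys_def heights_def one_enat_def)
qed (simp add: xy_polys_def)

text \<open>
  The words for the state \<open>1\<close> resolve \<open>C 1 = S/(x,y)S\<close>, and minimality holds because \<open>x\<close>, the column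
  generators and the powers \<open>y^c\<close> with \<open>c \<in> heights\<close> have no constant term.
\<close>

theorem residue_betti_eq: "residue_betti (M :: 'k::field poly poly set) i = betti_sequence r i"
proof -
  let ?R = "poly_ring_xy :: 'k poly poly ring"
  let ?M = "M :: 'k poly poly set"
  let ?S = "?R Quot ?M" and ?m = "ideal_xy ?M"
  let ?W = "W.words 1"
  let ?D = "\<lambda>u w. W.boundary w 1 u :: 'k poly poly"
  interpret R: cring ?R ..
  have M: "ideal ?M ?R"
    by (intro ideal_of_type_algebraI M_zero M_add M_mult)
  interpret M: ideal ?M ?R by fact
  interpret S: cring ?S by (rule M.quotient_is_cring[OF R.cring_axioms])
  note m = quotient_xy_maximalideal[OF M M_subset_xy_polys]
  interpret m: maximalideal ?m ?S by (rule m(2))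
  have valid: "W.valid w 1" "word_degree w = n" if "w \<in> ?W n" for w n
    using that by (auto simp: W.words_def)
  note xy = ideal_of_type_algebraD[OF xy_polys_ideal]
  obtain d \<epsilon> where "minimal_free_resolution ?S ((\<lambda>f. ?M +>\<^bsub>?R\<^esub> f) ` xy_polys)
      (quotient_module ?S ((\<lambda>f. ?M +>\<^bsub>?R\<^esub> f) ` xy_polys)) (\<lambda>n. card (?W n)) d \<epsilon>"
  proof (rule minimal_free_resolution_quotient[where W = ?W and D = ?D and base = Stop, OF M xy_polys_ideal M_subset_xy_polys])
    show "ideal ((\<lambda>f. ?M +>\<^bsub>?R\<^esub> f) ` xy_polys) ?S" using m.is_ideal m(1) by simp
    show "finite (?W n)" for n by (rule W.finite_words)
    show "?W 0 = {Stop}" by simp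
    show "?D (\<lambda>w. u w + v w) w = ?D u w + ?D v w" for u v w by (rule W.boundary_add)
    show "?D (\<lambda>w. c * u w) w = c * ?D u w" for c u w by (rule W.boundary_scale)
    show "?D u w \<in> M" if "w \<in> ?W n" "\<And>w'. w' \<in> ?W (Suc n) \<Longrightarrow> u w' \<in> M" for n u w
      using W.boundary_in_M[OF one_in_heights valid(1)[OF that(1)]] that valid(2) by metis
    show "?D u w \<in> xy_polys" if "w \<in> ?W n" for n u w
    proof (rule W.boundary_in_subideal[OF xy(1-3) _ _ _ one_in_heights valid(1)[OF that]])
      show "var_x \<in> xy_polys" by (simp add: xy_polys_def coeff_xy_def var_x_def)
    qed (auto intro: y_power_in_xy_polys col_gen_in_xy_polys)
    show "?D (?D u) w \<in> M" if "w \<in> ?W n" for n u w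
      by (rule W.boundary_boundary[OF one_in_heights valid(1)[OF that]])
    show "\<exists>v. \<forall>w\<in>?W (Suc n). u w - ?D v w \<in> M" if "\<forall>w\<in>?W n. ?D u w \<in> M" for n u
      using W.exact[OF one_in_heights, of n] that unfolding W.exact_at_def by blast
    show "\<exists>u. f - ?D u Stop \<in> M" if "f \<in> xy_polys" for f
    proof -
      from xy_polysE[OF that] obtain u v where "f = var_x * u + var_y * v" .
      then show ?thesis
        by (intro exI[of _ "\<lambda>w. if w = StepX then u else v"]) (simp add: M_zero one_enat_def)
    qed
  qed
  then have "minimal_free_resolution ?S ?m (quotient_module ?S ?m) (\<lambda>n. card (?W n)) d \<epsilon>"
    by (simp add: m(1))
  then have "betti_number ?S ?m (quotient_module ?S ?m) i = card (?W i)"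
    by (rule betti_number_eq[OF S.cring_axioms m(2) quotient_module_is_module[OF S.cring_axioms m.is_ideal]])
  then show ?thesis
    using card_words[of i] one_in_heights by (simp add: residue_betti_def Let_def finite_height_def)
qed

end

text \<open>
  Multiplying by the denominator turns the recursion into the vanishing of all coefficients from
  degree \<open>2\<close> on.
\<close>

lemma fps_betti_sequence:
  assumes "1 \<le> r"
  shows "Abs_fps (\<lambda>i. of_nat (betti_sequence r i)) =
    (1 + fps_X) / (1 - fps_X + (1 - of_nat r) * fps_X ^ 2 :: rat fps)"
proof -
  let ?P = "Abs_fps (\<lambda>i. of_nat (betti_sequence r i)) :: rat fps"
  let ?Q = "1 - fps_X + (1 - of_nat r) * fps_X ^ 2 :: rat fps"
  have "?P * ?Q = ?P - ?P * fps_X + fps_const (1 - of_nat r) * (?P * fps_X ^ 2)"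
    by (simp add: algebra_simps fps_of_nat fps_const_sub[symmetric] del: fps_const_sub)
  also have "\<dots> = 1 + fps_X"
  proof (rule fps_ext)
    fix n
    have X: "fps_nth (?P * fps_X ^ 2) n = (if n < 2 then 0 else of_nat (betti_sequence r (n - 2)))"
      by (simp add: fps_X_power_mult_right_nth)
    consider "n = 0" | "n = Suc 0" | m where "n = Suc (Suc m)" by (metis not0_implies_Suc)
    then show "fps_nth (?P - ?P * fps_X + fps_const (1 - of_nat r) * (?P * fps_X ^ 2)) n = fps_nth (1 + fps_X) n"
    proof cases
      case 3
      obtain q where "r = Suc q" using assms by (cases r) auto
      then show ?thesis using X 3 by simp
    qed (use X in simp_all)
  qed
  finally have "?P * ?Q = 1 + fps_X" .
  moreover have "?Q \<noteq> 0"
  proof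
    assume "?Q = 0"
    then have "fps_nth ?Q 0 = 0" by simp
    then show False by (simp add: fps_mult_nth_0)
  qed
  ultimately show ?thesis by (metis nonzero_mult_div_cancel_right)
qed

theorem theorem5p2:
  fixes a b :: "nat \<Rightarrow> nat" and r :: nat and M :: "'k::field poly poly set"
  assumes "strict_antimono_on {1..r} a"
    and "strict_mono_on {1..r} b"
    and "M = Idl\<^bsub>poly_ring_xy\<^esub> ((\<lambda>i. var_x ^ a i * var_y ^ b i) ` {1..r})"
    and "r > 2 \<or> (r = 2 \<and> \<not> generated_by_pure_powers M)"
  shows "(\<forall>i. residue_betti M i =
            (if i = 0 then 1
             else if i = 1 then 2
             else residue_betti M (i - 1) + (r - 1) * residue_betti M (i - 2))) \<and>
         poincare_betti_series M =
            (1 + fps_X) / (1 - fps_X + (1 - of_nat r) * fps_X ^ 2)"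
proof -
  have "b 1 > 0 \<or> a 2 > 0" if "r = 2"
  proof (rule ccontr)
    assume "\<not> (b 1 > 0 \<or> a 2 > 0)"
    moreover have "{1..r} = {1, 2}" using that by auto
    ultimately have "M = Idl\<^bsub>poly_ring_xy\<^esub> {var_x ^ a 1, var_y ^ b 2}" using assms(3) by simp
    then have "generated_by_pure_powers M"
      unfolding generated_by_pure_powers_def by (intro exI[of _ "{var_x ^ a 1, var_y ^ b 2}"]) auto
    then show False using assms(4) that by simp
  qed
  then interpret staircase a b r
    using assms(1,2,4) by unfold_locales auto
  have M: "M = staircase.M a b r" unfolding assms(3) by (rule M_eq_Idl[symmetric])
  have betti: "residue_betti M i = betti_sequence r i" for i
    unfolding M by (rule residue_betti_eq)
  have "betti_sequence r i = betti_sequence r (i - 1) + (r - 1) * betti_sequence r (i - 2)"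
    if "i \<noteq> 0" "i \<noteq> 1" for i
  proof -
    obtain n where "i = Suc (Suc n)" using \<open>i \<noteq> 0\<close> \<open>i \<noteq> 1\<close> by (metis One_nat_def not0_implies_Suc)
    then show ?thesis by simp
  qed
  then show ?thesis
    using fps_betti_sequence[of r] r_ge_2 by (simp add: betti poincare_betti_series_def)
qed

end
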